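(* $\mathcal{B}(\mathbb{C}_+)\neq\mathcal{A}(\mathbb{C}_+)$ and $\mathcal{B}_0(\mathbb{C}_+)\neq\mathcal{A}_0(\mathbb{C}_+)$.
   Context: Fourier transform $\widehat f(u)=\int f(t)e^{-itu}dt$; $H^1(\mathbb{R})=\{h\in L^1:\widehat h(u)=0\ \forall u\le0\}$. $\mathcal{A}_0(\mathbb{R})$ (resp. $\mathcal{A}(\mathbb{R})$): functions $F=\sum_kf_k\star h_k$ (pointwise) with $(f_k)$ in $C_0(\mathbb{R})$ (resp. bounded uniformly continuous functions $BUC(\mathbb{R})$), $(h_k)\subset H^1(\mathbb{R})$, $\sum\|f_k\|_\infty\|h_k\|_1<\infty$. Besov spaces: fix $\psi$ in the Schwartz class with $\mathrm{supp}\,\psi\subset[\frac12,2]$, $\psi\ge0$, $\psi(t)+\psi(t/2)=1$ on $[1,2]$; $\psi_k(t)=\psi(2^{-k}t)$, $\phi_k=\mathcal{F}^{-1}(\psi_k)$. $\mathcal{B}(\mathbb{R})=\{F\in BUC(\mathbb{R}):\sum_{k\in\mathbb{Z}}\|F\star\phi_k\|_\infty<\infty,\ F=\sum_kF\star\phi_k\}$ (independent of the choice of $\psi$), $\mathcal{B}_0(\mathbb{R})=\mathcal{B}(\mathbb{R})\cap C_0(\mathbb{R})$. For $F$ bounded with analytic Poisson extension $\mathcal{P}[F]$ to the upper half-plane, $\widetilde F(z)=\mathcal{P}[F](iz)$ on $\mathbb{C}_+=\{\mathrm{Re}\,z>0\}$, and $\mathcal{X}(\mathbb{C}_+)=\{\widetilde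 F:F\in\mathcal{X}(\mathbb{R})\}$ for $\mathcal{X}\in\{\mathcal{A},\mathcal{A}_0,\mathcal{B},\mathcal{B}_0\}$. *)

theory Defs
  imports "HOL-Analysis.Analysis"
begin

definition C0R :: "(real \<Rightarrow> complex) set" where
  "C0R = {f. continuous_on UNIV f \<and> (f \<longlongrightarrow> 0) at_infinity}"

definition BUCR :: "(real \<Rightarrow> complex) set" where
  "BUCR = {f. bounded (range f) \<and> uniformly_continuous_on UNIV f}"

definition supnorm :: "(real \<Rightarrow> complex) \<Rightarrow> real" where
  "supnorm f = (SUP x. norm (f x))"

definition L1norm :: "(real \<Rightarrow> complex) \<Rightarrow> real" where
  "L1norm h = integral\<^sup>L lborel (\<lambda>t. norm (h t))"

definition fourier :: "(real \<Rightarrow> complex) \<Rightarrow> real \<Rightarrow> complex" where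
  "fourier h u = integral\<^sup>L lborel (\<lambda>t. h t * exp (- \<i> * complex_of_real (t * u)))"

definition H1R :: "(real \<Rightarrow> complex) set" where
  "H1R = {h. integrable lborel h \<and> (\<forall>u\<le>0. fourier h u = 0)}"

definition conv :: "(real \<Rightarrow> complex) \<Rightarrow> (real \<Rightarrow> complex) \<Rightarrow> real \<Rightarrow> complex" where
  "conv f h x = integral\<^sup>L lborel (\<lambda>t. f (x - t) * h t)"

definition Aspace :: "(real \<Rightarrow> complex) set \<Rightarrow> (real \<Rightarrow> complex) set" where
  "Aspace X = {F. \<exists>f h :: nat \<Rightarrow> real \<Rightarrow> complex.
      (\<forall>k. f k \<in> X \<and> h k \<in> H1R) \<and>
      summable (\<lambda>k. supnorm (f k) * L1norm (h k)) \<and>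
      (\<forall>x. (\<lambda>k. conv (f k) (h k) x) sums F x)}"

definition AR :: "(real \<Rightarrow> complex) set" where "AR = Aspace BUCR"
definition A0R :: "(real \<Rightarrow> complex) set" where "A0R = Aspace C0R"

definition schwartz :: "(real \<Rightarrow> real) \<Rightarrow> bool" where
  "schwartz \<psi> \<longleftrightarrow> (\<forall>n x. ((deriv ^^ n) \<psi>) differentiable (at x)) \<and>
     (\<forall>m n. bounded (range (\<lambda>t. t ^ m * (deriv ^^ n) \<psi> t)))"

definition admissible :: "(real \<Rightarrow> real) \<Rightarrow> bool" where
  "admissible \<psi> \<longleftrightarrow> schwartz \<psi> \<and> closure {t. \<psi> t \<noteq> 0} \<subseteq> {1/2..2} \<and>
     (\<forall>t. \<psi> t \<ge> 0) \<and> (\<forall>t\<in>{1..2}. \<psi> t + \<psi> (t / 2) = 1)"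

text \<open>A fixed choice of psi (the spaces do not depend on the choice).\<close>
definition besov_psi :: "real \<Rightarrow> real" where
  "besov_psi = (SOME \<psi>. admissible \<psi>)"

definition phi :: "int \<Rightarrow> real \<Rightarrow> complex" where
  "phi k t = complex_of_real (1 / (2 * pi)) *
     integral\<^sup>L lborel (\<lambda>u. complex_of_real (besov_psi (2 powr (- real_of_int k) * u))
                         * exp (\<i> * complex_of_real (t * u)))"

definition BR :: "(real \<Rightarrow> complex) set" where
  "BR = {F. F \<in> BUCR \<and> (\<lambda>k. supnorm (conv F (phi k))) summable_on (UNIV :: int set) \<and>
            (\<forall>x. ((\<lambda>k. conv F (phi k) x) has_sum F x) UNIV)}"

definition B0R :: "(real \<Rightarrow> complex) set" where "B0R = BR \<inter> C0R"

definition poisson :: "(real \<Rightarrow> complex) \<Rightarrow> complex \<Rightarrow> complex" where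
  "poisson F z = integral\<^sup>L lborel
     (\<lambda>t. F t * complex_of_real (Im z / (pi * ((Re z - t)^2 + (Im z)^2))))"

definition tilde :: "(real \<Rightarrow> complex) \<Rightarrow> complex \<Rightarrow> complex" where
  "tilde F z = (if Re z > 0 then poisson F (\<i> * z) else 0)"

definition halfplane_space :: "(real \<Rightarrow> complex) set \<Rightarrow> (complex \<Rightarrow> complex) set" where
  "halfplane_space X = tilde ` X"

end

theory Submission
  imports Defs "HOL-Probability.Sinc_Integral" "HOL-Real_Asymp.Real_Asymp"
begin

text \<open>
  Let \<open>g\<^sub>k\<close> be the Fejer kernel (whose Fourier transform is a tent) modulated to the frequency
  \<open>3 \<cdot> 4\<^sup>k\<close>. Over the block \<open>2\<^sup>n \<le> k < 2\<^sup>n\<^sup>+\<^sup>1\<close> the function \<open>h\<^sub>n = 2\<^sup>-\<^sup>n \<Sum> g\<^sub>k\<close> has \<open>L\<^sup>1\<close> norm at most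
  \<open>2\<^sup>-\<^sup>n\<^sup>/\<^sup>2\<close>, because the \<open>g\<^sub>k\<close> share one nonnegative envelope for which the characters are orthonormal,
  while \<open>f\<^sub>n(t) = \<Sum> g\<^sub>k(t - k)\<close> is bounded uniformly in \<open>n\<close>, because the translates hardly overlap.
  Hence \<open>F = \<Sum> f\<^sub>n \<star> h\<^sub>n\<close> lies in both algebras. All spectra are disjoint, so \<open>F \<star> g\<^sub>k\<close> takes at \<open>k\<close> the value
  \<open>c \<cdot> 2\<^sup>-\<^sup>n\<close> with \<open>c \<noteq> 0\<close>. Since only two Littlewood-Paley pieces of \<open>F\<close> see \<open>g\<^sub>k\<close>, each block contributes at
  least a fixed amount to the Besov norm of \<open>F\<close>, which is therefore infinite. The Poisson extension
  determines bounded continuous boundary values, so the inequality passes to the half-plane.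
\<close>

section \<open>Existence of an admissible cutoff\<close>

text \<open>The classical flat function \<open>exp (- 1/x)\<close>, divided by powers of
  \<open>x\<close>. With the parameter \<open>n\<close> every derivative is a linear combination of
  members of the same family, so higher derivatives call for no explicit formula.\<close>

definition flat :: "nat \<Rightarrow> real \<Rightarrow> real" where
  "flat n x = (if x > 0 then exp (- inverse x) / x ^ n else 0)"

text \<open>On the right, \<open>y = 1/h\<close> turns the quotient into
  \<open>y ^ (n + 1) / exp y\<close>; on the left it is zero. The limit is the derivative of
  \<open>flat n\<close> at the origin, the only delicate point.\<close>

lemma flat_quotient_tendsto_0: "((\<lambda>h. flat n h / h) \<longlongrightarrow> 0) (at 0)"
proof -
  have "((\<lambda>y::real. y ^ Suc n / exp y) \<longlongrightarrow> 0) at_top"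
    by (rule tendsto_power_div_exp_0)
  then have "((\<lambda>h::real. inverse h ^ Suc n / exp (inverse h)) \<longlongrightarrow> 0) (at_right 0)"
    by (rule filterlim_compose[OF _ filterlim_inverse_at_top_right])
  moreover have "\<forall>\<^sub>F h in at_right (0::real). inverse h ^ Suc n / exp (inverse h) = flat n h / h"
    by (intro eventually_at_rightI[of 0 1]) (auto simp: flat_def exp_minus field_simps)
  ultimately have R: "((\<lambda>h. flat n h / h) \<longlongrightarrow> 0) (at_right 0)"
    by (rule Lim_transform_eventually)
  have "\<forall>\<^sub>F h in at_left (0::real). 0 = flat n h / h"
    by (intro eventually_at_leftI[of "-1"]) (auto simp: flat_def)
  then have L: "((\<lambda>h. flat n h / h) \<longlongrightarrow> 0) (at_left 0)"
    by (rule Lim_transform_eventually[OF tendsto_const])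
  from L R show ?thesis by (simp add: filterlim_split_at)
qed

lemma flat_has_derivative:
  "(flat n has_real_derivative flat (n + 2) x + (- real n) * flat (n + 1) x) (at x)"
proof -
  consider "x > 0" | "x < 0" | "x = 0" by linarith
  then show ?thesis
  proof cases
    case 1
    \<comment> \<open>\<open>n - Suc 0\<close> is truncated subtraction, so \<open>n = 0\<close> is
      a separate case; there the factor \<open>real n\<close> kills both sides.\<close>
    have power: "real n * x ^ (n - Suc 0) * x = real n * x ^ n"
      by (cases n) auto
    have "((\<lambda>x. exp (- inverse x) / x ^ n) has_real_derivative
        (exp (- inverse x) * inverse (x\<^sup>2) * x ^ n - exp (- inverse x) * (real n * x ^ (n - Suc 0))) /
        (x ^ n * x ^ n)) (at x)"
      using 1 by (auto intro!: derivative_eq_intros simp: power2_eq_square)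
    also have "(exp (- inverse x) * inverse (x\<^sup>2) * x ^ n - exp (- inverse x) * (real n * x ^ (n - Suc 0))) /
        (x ^ n * x ^ n) = exp (- inverse x) * inverse (x\<^sup>2) / x ^ n -
          exp (- inverse x) * (real n * x ^ (n - Suc 0) * x) / (x ^ n * x ^ n * x)"
      using 1 by (simp add: diff_divide_distrib)
    also have "\<dots> = flat (n + 2) x + (- real n) * flat (n + 1) x"
      unfolding power using 1 by (simp add: flat_def divide_inverse power_add power2_eq_square)
    finally have "((\<lambda>x. exp (- inverse x) / x ^ n) has_real_derivative
             flat (n + 2) x + (- real n) * flat (n + 1) x) (at x)" .
    then show ?thesis
      by (rule DERIV_cong_ev[THEN iffD1, rotated -1, OF _ refl _ refl])
         (use 1 in \<open>auto intro!: eventually_mono[OF eventually_nhds_in_open[of "{0<..}"]] simp: flat_def\<close>)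
  next
    case 2
    have "((\<lambda>x. 0) has_real_derivative flat (n + 2) x + (- real n) * flat (n + 1) x) (at x)"
      using 2 by (simp add: flat_def)
    then show ?thesis
      by (rule DERIV_cong_ev[THEN iffD1, rotated -1, OF _ refl _ refl])
         (use 2 in \<open>auto intro!: eventually_mono[OF eventually_nhds_in_open[of "{..<0}"]] simp: flat_def\<close>)
  next
    case 3
    then show ?thesis
      using flat_quotient_tendsto_0[of n] by (simp add: DERIV_def flat_def)
  qed
qed

text \<open>A class whose generating rules make it closed under differentiation, so that a single
  induction covers all iterated derivatives. The affine argument admits dilations and reflections,
  and \<open>inverse\<close> admits the quotient in \<open>smooth_step\<close>.\<close>

inductive_set smooth_alg :: "(real \<Rightarrow> real) set" where
  flat: "(\<lambda>x. flat n (a + b * x)) \<in> smooth_alg"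
| const: "(\<lambda>x. c) \<in> smooth_alg"
| add: "f \<in> smooth_alg \<Longrightarrow> g \<in> smooth_alg \<Longrightarrow> (\<lambda>x. f x + g x) \<in> smooth_alg"
| mult: "f \<in> smooth_alg \<Longrightarrow> g \<in> smooth_alg \<Longrightarrow> (\<lambda>x. f x * g x) \<in> smooth_alg"
| inverse: "f \<in> smooth_alg \<Longrightarrow> (\<And>x. f x \<noteq> 0) \<Longrightarrow> (\<lambda>x. inverse (f x)) \<in> smooth_alg"

lemma smooth_alg_has_derivative:
  assumes "f \<in> smooth_alg"
  shows "\<exists>f'\<in>smooth_alg. \<forall>x. (f has_real_derivative f' x) (at x)"
  using assms
proof induction
  case (flat n a b)
  let ?f' = "\<lambda>x. b * (flat (n + 2) (a + b * x) + (- real n) * flat (n + 1) (a + b * x))"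
  have "((\<lambda>x. flat n (a + b * x)) has_real_derivative ?f' x) (at x)" for x
  proof -
    have "((\<lambda>x. a + b * x) has_real_derivative b) (at x)"
      by (auto intro!: derivative_eq_intros)
    from DERIV_chain2[OF flat_has_derivative this] show ?thesis
      by (simp add: mult.commute)
  qed
  moreover have "?f' \<in> smooth_alg"
    by (intro smooth_alg.intros)
  ultimately show ?case by (intro bexI[of _ ?f'] allI)
next
  case (const c)
  then show ?case by (intro bexI[of _ "\<lambda>x. 0"]) (auto intro: smooth_alg.const)
next
  case (add f g)
  then obtain f' g' where D: "f' \<in> smooth_alg" "g' \<in> smooth_alg"
    "\<And>x. (f has_real_derivative f' x) (at x)" "\<And>x. (g has_real_derivative g' x) (at x)" by blast
  then show ?case
    by (intro bexI[of _ "\<lambda>x. f' x + g' x"]) (auto intro: smooth_alg.intros derivative_intros)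
next
  case (mult f g)
  then obtain f' g' where D: "f' \<in> smooth_alg" "g' \<in> smooth_alg"
    "\<And>x. (f has_real_derivative f' x) (at x)" "\<And>x. (g has_real_derivative g' x) (at x)" by blast
  have "(\<lambda>x. f' x * g x + g' x * f x) \<in> smooth_alg"
    using D(1,2) mult.hyps by (intro smooth_alg.intros)
  then show ?case
    using D(3,4) by (intro bexI[of _ "\<lambda>x. f' x * g x + g' x * f x"] allI DERIV_mult) auto
next
  case (inverse f)
  then obtain f' where D: "f' \<in> smooth_alg"
    "\<And>x. (f has_real_derivative f' x) (at x)" by blast
  have "(\<lambda>x. (- 1) * (inverse (f x) * (f' x * inverse (f x)))) \<in> smooth_alg"
    using D(1) inverse.hyps by (intro smooth_alg.intros)
  moreover have "((\<lambda>x. inverse (f x)) has_real_derivative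
      (- 1) * (inverse (f x) * (f' x * inverse (f x)))) (at x)" for x
    using DERIV_inverse'[OF D(2) inverse.hyps(2), of x] by (simp add: mult.assoc)
  ultimately show ?case
    by (intro bexI[of _ "\<lambda>x. (- 1) * (inverse (f x) * (f' x * inverse (f x)))"] allI)
qed

lemma smooth_alg_funpow_deriv:
  assumes "f \<in> smooth_alg"
  shows "(deriv ^^ n) f \<in> smooth_alg"
proof (induction n)
  case (Suc n)
  from smooth_alg_has_derivative[OF this] obtain f'
    where f': "f' \<in> smooth_alg" "\<forall>x. ((deriv ^^ n) f has_real_derivative f' x) (at x)" by blast
  then have "deriv ((deriv ^^ n) f) = f'" by (auto intro!: DERIV_imp_deriv)
  with f' show ?case by simp
qed (use assms in simp)

lemma smooth_alg_funpow_deriv_differentiable: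
  assumes "f \<in> smooth_alg"
  shows "(deriv ^^ n) f differentiable (at x)"
  using smooth_alg_has_derivative[OF smooth_alg_funpow_deriv[OF assms]]
  by (meson real_differentiable_def)

text \<open>The complement of \<open>K\<close> is open, so a function vanishing there vanishes near
  each such point, and so does its derivative.\<close>

lemma funpow_deriv_eq_0_outside:
  fixes f :: "real \<Rightarrow> real"
  assumes "closed K" and "\<And>x. x \<notin> K \<Longrightarrow> f x = 0" and "x \<notin> K"
  shows "(deriv ^^ n) f x = 0"
  using assms(3)
proof (induction n arbitrary: x)
  case 0
  then show ?case using assms(2) by simp
next
  case (Suc n)
  have "((deriv ^^ n) f has_real_derivative 0) (at x)"
  proof (rule DERIV_cong_ev[THEN iffD2, OF refl _ refl])
    show "\<forall>\<^sub>F y in nhds x. (deriv ^^ n) f y = 0"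
      using Suc assms(1) by (auto intro!: eventually_mono[OF eventually_nhds_in_open[of "- K"]])
  qed simp
  then show ?case by (simp add: DERIV_imp_deriv)
qed

lemma schwartz_if_smooth_compact_support:
  fixes f :: "real \<Rightarrow> real"
  assumes diff: "\<And>n x. (deriv ^^ n) f differentiable (at x)" and "\<And>x. x \<notin> {a..b} \<Longrightarrow> f x = 0"
  shows "schwartz f"
  unfolding schwartz_def
proof (intro conjI allI)
  fix m n
  let ?g = "\<lambda>t. t ^ m * (deriv ^^ n) f t"
  have "continuous_on UNIV ((deriv ^^ n) f)"
    by (metis diff continuous_at_imp_continuous_on differentiable_imp_continuous_within)
  then have "continuous_on {a..b} ?g"
    by (intro continuous_intros) (auto intro: continuous_on_subset)
  then have "bounded (?g ` {a..b})"
    by (intro compact_imp_bounded compact_continuous_image) auto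
  moreover have "range ?g \<subseteq> insert 0 (?g ` {a..b})"
  proof
    fix y assume "y \<in> range ?g"
    then obtain t where "y = ?g t" by blast
    then show "y \<in> insert 0 (?g ` {a..b})"
      using funpow_deriv_eq_0_outside[of "{a..b}" f t n] assms(2) by (cases "t \<in> {a..b}") auto
  qed
  ultimately show "bounded (range ?g)"
    by (meson bounded_insert bounded_subset)
qed (use diff in auto)

text \<open>A smooth monotone transition from 0 to 1 across \<open>[1, 2]\<close>; a difference of
  two of its dilates will be the cutoff.\<close>

definition smooth_step :: "real \<Rightarrow> real" where
  "smooth_step x = flat 0 (x - 1) / (flat 0 (x - 1) + flat 0 (2 - x))"

lemma flat_mono: "x \<le> y \<Longrightarrow> flat 0 x \<le> flat 0 y"
  by (auto simp: flat_def le_imp_inverse_le)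

lemma flat_nonneg: "0 \<le> flat n x"
  by (auto simp: flat_def)

lemma smooth_step_denom_pos: "0 < flat 0 (x - 1) + flat 0 (2 - x)"
  using flat_nonneg[of 0 "x - 1"] flat_nonneg[of 0 "2 - x"]
  by (cases "x > 1") (auto simp: flat_def intro: add_pos_nonneg)

lemma smooth_step_in_smooth_alg: "(\<lambda>x. smooth_step (c * x)) \<in> smooth_alg"
proof -
  have nz: "flat 0 (- 1 + c * x) + flat 0 (2 + (- c) * x) \<noteq> 0" for x
    using smooth_step_denom_pos[of "c * x"] by simp
  have "(\<lambda>x. flat 0 (- 1 + c * x) * inverse (flat 0 (- 1 + c * x) + flat 0 (2 + (- c) * x))) \<in> smooth_alg"
    by (rule smooth_alg.mult[OF smooth_alg.flat smooth_alg.inverse[OF smooth_alg.add[OF smooth_alg.flat smooth_alg.flat] nz]])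
  then show ?thesis by (simp add: smooth_step_def divide_inverse)
qed

lemma smooth_step_mono: "x \<le> y \<Longrightarrow> smooth_step x \<le> smooth_step y"
proof -
  assume "x \<le> y"
  then have 1: "flat 0 (x - 1) \<le> flat 0 (y - 1)" "flat 0 (2 - y) \<le> flat 0 (2 - x)"
    by (auto intro: flat_mono)
  \<comment> \<open>Clearing denominators in the goal, the common term
    \<open>flat 0 (x - 1) * flat 0 (y - 1)\<close> cancels and exactly this inequality
    remains.\<close>
  have "flat 0 (x - 1) * flat 0 (2 - y) \<le> flat 0 (y - 1) * flat 0 (2 - x)"
    using 1 by (intro mult_mono flat_nonneg)
  then show ?thesis
    using smooth_step_denom_pos[of x] smooth_step_denom_pos[of y]
    by (simp add: smooth_step_def divide_simps algebra_simps)
qed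

lemma smooth_step_eq_0: "x \<le> 1 \<Longrightarrow> smooth_step x = 0"
  and smooth_step_eq_1: "2 \<le> x \<Longrightarrow> smooth_step x = 1"
  by (auto simp: smooth_step_def flat_def)

text \<open>With \<open>S = smooth_step\<close> take \<open>S (2 * t) - S t\<close>. The sum of the
  values at \<open>t\<close> and \<open>t / 2\<close> telescopes to
  \<open>S (2 * t) - S (t / 2)\<close>, which is \<open>1 - 0\<close> on \<open>[1, 2]\<close>;
  monotonicity of \<open>S\<close> gives the sign.\<close>

lemma ex_admissible: "\<exists>\<psi>. admissible \<psi>"
proof
  define \<psi> where "\<psi> = (\<lambda>x. smooth_step (2 * x) + (- 1) * smooth_step (1 * x))"
  have zero: "\<psi> x = 0" if "x \<notin> {1/2..2}" for x
    using that by (auto simp: \<psi>_def not_le smooth_step_eq_0 smooth_step_eq_1)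
  have "\<psi> \<in> smooth_alg"
    unfolding \<psi>_def by (intro smooth_alg.intros smooth_step_in_smooth_alg)
  then have "schwartz \<psi>"
    using zero by (intro schwartz_if_smooth_compact_support smooth_alg_funpow_deriv_differentiable)
  moreover have "closure {t. \<psi> t \<noteq> 0} \<subseteq> {1/2..2}"
    using zero by (intro closure_minimal) (blast, simp)
  moreover have "\<psi> t \<ge> 0" for t
  proof (cases "t \<ge> 0")
    case True
    then show ?thesis using smooth_step_mono[of t "2 * t"] by (simp add: \<psi>_def)
  qed (use zero in auto)
  moreover have "\<psi> t + \<psi> (t / 2) = 1" if "t \<in> {1..2}" for t
    using that by (simp add: \<psi>_def smooth_step_eq_0 smooth_step_eq_1)
  ultimately show "admissible \<psi>" by (auto simp: admissible_def)
qed

lemma admissible_besov_psi: "admissible besov_psi"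
  unfolding besov_psi_def using ex_admissible by (rule someI_ex)

section \<open>Poisson kernel and Fourier inversion\<close>

lemma integrable_inverse_1_plus_square_lborel: "integrable lborel (\<lambda>v::real. 1 / (1 + v\<^sup>2))"
  using integrable_inverse_1_plus_square by (simp add: set_integrable_def inverse_eq_divide)

lemma integral_inverse_1_plus_square_lborel: "(\<integral>v. 1 / (1 + v\<^sup>2) \<partial>lborel) = (pi::real)"
  using LBINT_inverse_1_plus_square
  by (simp add: interval_lebesgue_integral_def set_lebesgue_integral_def inverse_eq_divide)

lemma borel_measurable_lborel_continuous:
  fixes f :: "real \<Rightarrow> 'a :: real_normed_vector"
  shows "continuous_on UNIV f \<Longrightarrow> f \<in> borel_measurable lborel"
  by (simp add: borel_measurable_continuous_onI)

lemma lborel_integral_shift: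
  fixes f :: "real \<Rightarrow> 'a :: {banach, second_countable_topology}"
  shows "(\<integral>x. f (x - t) \<partial>lborel) = (\<integral>x. f x \<partial>lborel)"
  using lborel_integral_real_affine[of 1 f "- t"] by simp

lemma lborel_integrable_shift:
  fixes f :: "real \<Rightarrow> 'a :: {banach, second_countable_topology}"
  shows "integrable lborel f \<Longrightarrow> integrable lborel (\<lambda>x. f (x - t))"
  using lborel_integrable_real_affine[of f 1 "- t"] by simp

text \<open>For fixed \<open>t\<close> the shear is a translation in \<open>v\<close>, so by Tonelli
  the norm integrates to the product of the two L1 norms, and a bounded kernel preserves
  integrability. The value \<open>c = 0\<close> serves the Fourier exchanges below,
  \<open>c = 1\<close> the associativity of convolution.\<close>

lemma integrable_sheared_pair:
  fixes a b :: "real \<Rightarrow> complex" and k :: "real \<Rightarrow> real \<Rightarrow> complex"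
  assumes a: "integrable lborel a" and b: "integrable lborel b"
    and k: "(\<lambda>(t, v). k t v) \<in> borel_measurable (borel \<Otimes>\<^sub>M borel)" and bound: "\<And>t v. norm (k t v) \<le> M"
  shows "integrable (lborel \<Otimes>\<^sub>M lborel) (\<lambda>(t, v). a t * b (v - c * t) * k t v)"
proof -
  have [measurable]: "a \<in> borel_measurable borel" "b \<in> borel_measurable borel"
    "(\<lambda>(t, v). k t v) \<in> borel_measurable (borel \<Otimes>\<^sub>M borel)"
    using borel_measurable_integrable[OF a] borel_measurable_integrable[OF b] k by simp_all
  have "integrable (lborel \<Otimes>\<^sub>M lborel) (\<lambda>(t, v). a t * b (v - c * t))"
  proof (rule lborel_pair.Fubini_integrable)
    have "(\<lambda>x. \<integral>y. norm (case (x, y) of (t, v) \<Rightarrow> a t * b (v - c * t)) \<partial>lborel) =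
        (\<lambda>t. norm (a t) * (\<integral>v. norm (b v) \<partial>lborel))"
      using lborel_integral_shift[of "\<lambda>v. norm (b v)"] by (simp add: norm_mult)
    then show "integrable lborel (\<lambda>x. \<integral>y. norm (case (x, y) of (t, v) \<Rightarrow> a t * b (v - c * t)) \<partial>lborel)"
      using a by simp
    show "AE x in lborel. integrable lborel (\<lambda>y. case (x, y) of (t, v) \<Rightarrow> a t * b (v - c * t))"
      using lborel_integrable_shift[OF b] by simp
  qed measurable
  then have "integrable (lborel \<Otimes>\<^sub>M lborel) (\<lambda>z. M * norm (case z of (t, v) \<Rightarrow> a t * b (v - c * t)))"
    by simp
  then show ?thesis
  proof (rule Bochner_Integration.integrable_bound)
    show "AE z in lborel \<Otimes>\<^sub>M lborel. norm (case z of (t, v) \<Rightarrow> a t * b (v - c * t) * k t v)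
        \<le> norm (M * norm (case z of (t, v) \<Rightarrow> a t * b (v - c * t)))"
    proof (intro AE_I2, clarify)
      fix t v
      have "norm (a t * b (v - c * t)) * norm (k t v) \<le> norm (a t * b (v - c * t)) * M"
        by (intro mult_left_mono bound) auto
      moreover have "0 \<le> M" using bound[of t v] norm_ge_zero order_trans by blast
      ultimately show "norm (a t * b (v - c * t) * k t v) \<le> norm (M * norm (a t * b (v - c * t)))"
        by (simp add: norm_mult mult_ac)
    qed
  qed measurable
qed

lemma integral_sheared_swap:
  fixes a b :: "real \<Rightarrow> complex" and k :: "real \<Rightarrow> real \<Rightarrow> complex"
  assumes "integrable lborel a" "integrable lborel b"
    "(\<lambda>(t, v). k t v) \<in> borel_measurable (borel \<Otimes>\<^sub>M borel)" "\<And>t v. norm (k t v) \<le> M"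
  shows "(\<integral>t. \<integral>v. a t * b (v - c * t) * k t v \<partial>lborel \<partial>lborel) =
         (\<integral>v. \<integral>t. a t * b (v - c * t) * k t v \<partial>lborel \<partial>lborel)"
  using lborel_pair.Fubini_integral[OF integrable_sheared_pair[OF assms, of c]] by simp

lemma norm_exp_i_times_real [simp]: "norm (exp (\<i> * complex_of_real x)) = 1"
  "norm (exp (- (\<i> * complex_of_real x))) = 1"
  by (simp_all add: norm_exp_eq_Re)

text \<open>The substitution \<open>t = x + y * v\<close> turns the Poisson kernel at height
  \<open>y\<close> into the fixed Cauchy density \<open>1 / (pi * (1 + v^2))\<close>; continuity and
  dominated convergence then give the limit.\<close>

lemma poisson_tendsto:
  assumes cont: "continuous_on UNIV F" and bound: "\<And>t. norm (F t) \<le> M"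
  shows "(\<lambda>n. poisson F (Complex x (inverse (Suc n)))) \<longlonglongrightarrow> F x"
proof -
  let ?w = "\<lambda>v::real. complex_of_real (1 / (pi * (1 + v\<^sup>2)))"
  have [measurable]: "F \<in> borel_measurable borel"
    using cont by (rule borel_measurable_continuous_onI)
  have "poisson F (Complex x y) = (\<integral>v. F (x + y * v) * ?w v \<partial>lborel)" if "y > 0" for y
  proof -
    have "y * y / (pi * ((y * v)\<^sup>2 + y\<^sup>2)) = 1 / (pi * (1 + v\<^sup>2))" for v
    proof -
      have "(y * v)\<^sup>2 + y\<^sup>2 = (y * y) * (1 + v\<^sup>2)" by (simp add: power2_eq_square algebra_simps)
      then show ?thesis using that by simp
    qed
    moreover have "(x - (x + y * v))\<^sup>2 = (y * v)\<^sup>2" for v by (simp add: power2_eq_square)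
    ultimately have "y * (y / (pi * ((x - (x + y * v))\<^sup>2 + y\<^sup>2))) = 1 / (pi * (1 + v\<^sup>2))" for v
      by simp
    then have "complex_of_real y * (F (x + y * v) *
        complex_of_real (y / (pi * ((x - (x + y * v))\<^sup>2 + y\<^sup>2)))) = F (x + y * v) * ?w v" for v
      by (metis mult.left_commute of_real_mult)
    moreover have "poisson F (Complex x y) = complex_of_real y * (\<integral>v. F (x + y * v) *
        complex_of_real (y / (pi * ((x - (x + y * v))\<^sup>2 + y\<^sup>2))) \<partial>lborel)"
      unfolding poisson_def complex.sel
      using that by (subst lborel_integral_real_affine[where c = y and t = x])
         (simp, simp only: scaleR_conv_of_real abs_of_pos)
    ultimately show ?thesis
      by (simp only: flip: integral_mult_right_zero)
  qed
  then have P: "poisson F (Complex x (inverse (Suc n))) =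
      (\<integral>v. F (x + inverse (Suc n) * v) * ?w v \<partial>lborel)" for n by simp
  have w: "integrable lborel (\<lambda>v::real. 1 / (pi * (1 + v\<^sup>2)))" "(\<integral>v. 1 / (pi * (1 + v\<^sup>2)) \<partial>lborel) = (1::real)"
    using integrable_mult_right[OF integrable_inverse_1_plus_square_lborel, of "1 / pi"]
      integral_mult_right_zero[of lborel "1 / pi" "\<lambda>v. 1 / (1 + v\<^sup>2)"]
    by (simp_all add: integral_inverse_1_plus_square_lborel)
  have "(\<lambda>n. \<integral>v. F (x + inverse (Suc n) * v) * ?w v \<partial>lborel) \<longlonglongrightarrow> (\<integral>v. F x * ?w v \<partial>lborel)"
  proof (rule integral_dominated_convergence[where w = "\<lambda>v. M * (1 / (pi * (1 + v\<^sup>2)))"])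
    show "integrable lborel (\<lambda>v. M * (1 / (pi * (1 + v\<^sup>2))))"
      by (rule integrable_mult_right[OF w(1)])
    show "AE v in lborel. (\<lambda>n. F (x + inverse (Suc n) * v) * ?w v) \<longlonglongrightarrow> F x * ?w v"
    proof (intro AE_I2 tendsto_mult tendsto_const)
      fix v
      have "(\<lambda>n. x + inverse (Suc n) * v) \<longlonglongrightarrow> x + 0 * v"
        by (intro tendsto_intros LIMSEQ_inverse_real_of_nat)
      moreover have "isCont F x" using cont by (simp add: continuous_on_eq_continuous_at)
      ultimately show "(\<lambda>n. F (x + inverse (Suc n) * v)) \<longlonglongrightarrow> F x"
        by (intro isCont_tendsto_compose[of x F]) auto
    qed
    show "AE v in lborel. norm (F (x + inverse (Suc n) * v) * ?w v) \<le> M * (1 / (pi * (1 + v\<^sup>2)))" for n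
    proof (intro AE_I2)
      fix v :: real
      have "0 \<le> 1 / (pi * (1 + v\<^sup>2))" by simp
      then show "norm (F (x + inverse (Suc n) * v) * ?w v) \<le> M * (1 / (pi * (1 + v\<^sup>2)))"
        unfolding norm_mult norm_of_real by (intro mult_mono bound) (auto intro: order_trans[OF norm_ge_zero bound])
    qed
  qed measurable
  moreover have "(\<integral>v. F x * ?w v \<partial>lborel) = F x"
    using w(2) by (simp del: of_real_divide of_real_mult)
  ultimately show ?thesis unfolding P by simp
qed

text \<open>Uniqueness of boundary values: the rotation \<open>\<i> * z\<close> sends
  \<open>Complex y (- x)\<close> to \<open>Complex x y\<close>, so \<open>tilde\<close> determines
  every Poisson integral, and letting \<open>y\<close> tend to 0 recovers the function.\<close>

lemma tilde_eq_imp_eq: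
  assumes "tilde F = tilde G" "continuous_on UNIV F" "continuous_on UNIV G"
    "\<And>t. norm (F t) \<le> M" "\<And>t. norm (G t) \<le> N"
  shows "F = G"
proof
  fix x
  have "poisson F (Complex x y) = poisson G (Complex x y)" if "y > 0" for y
  proof -
    have "\<i> * Complex y (- x) = Complex x y" by (simp add: complex_eq_iff)
    then show ?thesis
      using fun_cong[OF assms(1), of "Complex y (- x)"] that by (simp add: tilde_def)
  qed
  then have "(\<lambda>n. poisson F (Complex x (inverse (Suc n)))) = (\<lambda>n. poisson G (Complex x (inverse (Suc n))))"
    by simp
  then show "F x = G x"
    using poisson_tendsto[OF assms(2,4), of x] poisson_tendsto[OF assms(3,5), of x] LIMSEQ_unique by metis
qed

lemma has_bochner_integral_exp_halfline:
  fixes z :: complex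
  assumes "Re z > 0"
  shows "has_bochner_integral lborel (\<lambda>t. indicator {0<..} t *\<^sub>R exp (- (of_real t * z))) (1 / z)"
proof -
  have z: "z \<noteq> 0" using assms by auto
  have [measurable]: "(\<lambda>t. exp (- (complex_of_real t * z))) \<in> borel_measurable borel"
    by (intro borel_measurable_continuous_onI continuous_intros)
  have int: "set_integrable lborel {0<..} (\<lambda>t. exp (- (of_real t * z)))"
    unfolding set_integrable_def
  proof (rule Bochner_Integration.integrable_bound)
    show "integrable lborel (\<lambda>t. indicator {0<..} t *\<^sub>R exp (- (t * Re z)))"
      using integrable_I0i_exp_mscale[OF assms] by (simp add: set_integrable_def)
    show "AE t in lborel. norm (indicator {0<..} t *\<^sub>R exp (- (complex_of_real t * z)))
        \<le> norm (indicator {0<..} t *\<^sub>R exp (- (t * Re z)))"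
      by (intro AE_I2) (simp add: norm_exp_eq_Re)
  qed measurable
  have "(LBINT t=0..\<infinity>. exp (- (of_real t * z))) = 0 - (- 1 / z)"
  proof (rule interval_integral_FTC_integrable[where F = "\<lambda>t. - exp (- (of_real t * z)) / z"])
    show "((\<lambda>t. - exp (- (complex_of_real t * z)) / z) has_vector_derivative exp (- (complex_of_real t * z))) (at t)" for t
      using z unfolding has_real_derivative_iff_has_vector_derivative[symmetric]
      by (auto intro!: derivative_eq_intros has_vector_derivative_real_field simp: field_simps)
    show "set_integrable lborel (einterval 0 \<infinity>) (\<lambda>t. exp (- (complex_of_real t * z)))"
      using int by (simp add: zero_ereal_def)
    show "(((\<lambda>t. - exp (- (complex_of_real t * z)) / z) \<circ> real_of_ereal) \<longlongrightarrow> - 1 / z) (at_right 0)"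
      unfolding zero_ereal_def ereal_tendsto_simps using z by (auto intro!: tendsto_eq_intros)
    have "((\<lambda>t. exp (- (complex_of_real t * z))) \<longlongrightarrow> 0) at_top"
    proof (rule tendsto_norm_zero_cancel)
      have "filterlim (\<lambda>t. Re z * t) at_top at_top"
        using assms by (intro filterlim_tendsto_pos_mult_at_top[OF tendsto_const] filterlim_ident)
      then have "filterlim (\<lambda>t. - (t * Re z)) at_bot at_top"
        by (simp add: filterlim_uminus_at_top mult.commute)
      then have "((\<lambda>t. exp (- (t * Re z))) \<longlongrightarrow> 0) at_top"
        by (rule filterlim_compose[OF exp_at_bot])
      then show "((\<lambda>t. norm (exp (- (complex_of_real t * z)))) \<longlongrightarrow> 0) at_top"
        by (simp add: norm_exp_eq_Re)
    qed
    then have "((\<lambda>t. - exp (- (complex_of_real t * z)) / z) \<longlongrightarrow> - 0 / z) at_top"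
      using z by (intro tendsto_intros)
    then show "(((\<lambda>t. - exp (- (complex_of_real t * z)) / z) \<circ> real_of_ereal) \<longlongrightarrow> 0) (at_left \<infinity>)"
      by (simp add: ereal_tendsto_simps)
  qed (auto intro!: continuous_intros)
  then show ?thesis
    using int unfolding has_bochner_integral_iff
    by (simp add: set_integrable_def interval_lebesgue_integral_def set_lebesgue_integral_def zero_ereal_def)
qed

text \<open>The Poisson kernel as a Fourier transform. The two half-lines contribute
  \<open>1 / z\<close> and \<open>1 / z'\<close> with \<open>z = y - \<i> * u\<close> and
  \<open>z' = y + \<i> * u\<close>, whose sum is \<open>2 * y / (y^2 + u^2)\<close>.\<close>

lemma has_bochner_integral_exp_abs:
  fixes y u :: real
  assumes "y > 0"
  shows "has_bochner_integral lborel (\<lambda>t. exp (- (y * \<bar>t\<bar>)) * exp (\<i> * of_real (t * u)))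
    (of_real (2 * y / (y\<^sup>2 + u\<^sup>2)))"
proof -
  let ?z = "Complex y (- u)" and ?z' = "Complex y u"
  have 1: "has_bochner_integral lborel (\<lambda>t. indicator {0<..} t *\<^sub>R exp (- (of_real t * ?z))) (1 / ?z)"
    using assms by (intro has_bochner_integral_exp_halfline) simp
  have "has_bochner_integral lborel (\<lambda>t. indicator {0<..} t *\<^sub>R exp (- (of_real t * ?z'))) (1 / ?z')"
    using assms by (intro has_bochner_integral_exp_halfline) simp
  then have 2: "has_bochner_integral lborel
      (\<lambda>t. indicator {0<..} (- t) *\<^sub>R exp (- (of_real (- t) * ?z'))) (1 / ?z')"
    by (subst (asm) lborel_has_bochner_integral_real_affine_iff[of "- 1" _ _ 0])
       (simp_all only: abs_minus_cancel abs_one inverse_1 scaleR_one add_0 mult_minus1 neg_equal_zero one_neq_zero not_False_eq_True)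
  have "1 / ?z + 1 / ?z' = complex_of_real (2 * y / (y\<^sup>2 + u\<^sup>2))"
  proof -
    have "?z * ?z' = of_real (y\<^sup>2 + u\<^sup>2)" "?z + ?z' = of_real (2 * y)"
      by (simp_all add: complex_eq_iff power2_eq_square)
    moreover have "?z \<noteq> 0" "?z' \<noteq> 0" using assms by (auto simp: complex_eq_iff)
    ultimately show ?thesis by (simp add: add_frac_eq add.commute mult.commute)
  qed
  with has_bochner_integral_add[OF 1 2]
  have "has_bochner_integral lborel (\<lambda>t. indicator {0<..} t *\<^sub>R exp (- (of_real t * ?z)) +
      indicator {0<..} (- t) *\<^sub>R exp (- (of_real (- t) * ?z'))) (of_real (2 * y / (y\<^sup>2 + u\<^sup>2)))" by simp
  then show ?thesis
  proof (rule has_bochner_integral_cong_AE[THEN iffD1, rotated -1])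
    have "exp (- (complex_of_real t * ?z)) = exp (- (y * t)) * exp (\<i> * of_real (t * u))" for t
      unfolding exp_of_real[symmetric] exp_add[symmetric]
      by (intro arg_cong[where f = exp]) (simp add: complex_eq_iff)
    moreover have "exp (complex_of_real t * ?z') = exp (- (y * (- t))) * exp (\<i> * of_real (t * u))" for t
      unfolding exp_of_real[symmetric] exp_add[symmetric]
      by (intro arg_cong[where f = exp]) (simp add: complex_eq_iff)
    \<comment> \<open>Both half-lines are open, so the sum of the pieces is 0 at
      \<open>t = 0\<close>; that single point is a null set.\<close>
    ultimately show "AE t in lborel. indicator {0<..} t *\<^sub>R exp (- (of_real t * ?z)) +
      indicator {0<..} (- t) *\<^sub>R exp (- (of_real (- t) * ?z')) = exp (- (y * \<bar>t\<bar>)) * exp (\<i> * of_real (t * u))"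
      by (intro eventually_mono[OF AE_lborel_singleton[of 0]]) (auto simp: indicator_def)
  next
    show "(\<lambda>t. complex_of_real (exp (- (y * \<bar>t\<bar>))) * exp (\<i> * of_real (t * u))) \<in> borel_measurable lborel"
      by (intro borel_measurable_lborel_continuous continuous_intros)
  qed (use has_bochner_integral_add[OF 1 2] in \<open>simp add: has_bochner_integral_iff borel_measurable_integrable\<close>)
qed

section \<open>The inverse Fourier transform\<close>

definition inv_fourier :: "(real \<Rightarrow> complex) \<Rightarrow> real \<Rightarrow> complex" where
  "inv_fourier \<tau> x = complex_of_real (1 / (2 * pi)) * (\<integral>u. \<tau> u * exp (\<i> * of_real (x * u)) \<partial>lborel)"

lemma continuous_on_inv_fourier:
  assumes "integrable lborel \<tau>"
  shows "continuous_on UNIV (inv_fourier \<tau>)"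
proof -
  have [measurable]: "\<tau> \<in> borel_measurable borel" using borel_measurable_integrable[OF assms] by simp
  have [measurable]: "(\<lambda>u. exp (\<i> * complex_of_real (x * u))) \<in> borel_measurable borel" for x :: real
    by (intro borel_measurable_continuous_onI continuous_intros)
  have "(\<lambda>n. \<integral>u. \<tau> u * exp (\<i> * of_real (X n * u)) \<partial>lborel) \<longlonglongrightarrow> (\<integral>u. \<tau> u * exp (\<i> * of_real (x * u)) \<partial>lborel)"
    if X: "X \<longlonglongrightarrow> x" for X :: "nat \<Rightarrow> real" and x
  proof (rule integral_dominated_convergence[where w = "\<lambda>u. norm (\<tau> u)"])
    show "AE u in lborel. (\<lambda>n. \<tau> u * exp (\<i> * of_real (X n * u))) \<longlonglongrightarrow> \<tau> u * exp (\<i> * of_real (x * u))"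
      using X by (intro AE_I2 tendsto_intros)
  qed (use assms in \<open>auto simp: norm_mult\<close>)
  then have "continuous_on UNIV (\<lambda>x. \<integral>u. \<tau> u * exp (\<i> * of_real (x * u)) \<partial>lborel)"
    by (auto simp: continuous_on_sequentially o_def)
  then show ?thesis unfolding inv_fourier_def by (intro continuous_intros)
qed

lemma norm_inv_fourier_le: "norm (inv_fourier \<tau> x) \<le> (\<integral>u. norm (\<tau> u) \<partial>lborel) / (2 * pi)"
proof -
  have "norm (\<integral>u. \<tau> u * exp (\<i> * of_real (x * u)) \<partial>lborel) \<le> (\<integral>u. norm (\<tau> u * exp (\<i> * of_real (x * u))) \<partial>lborel)"
    by (rule integral_norm_bound)
  also have "\<dots> = (\<integral>u. norm (\<tau> u) \<partial>lborel)" by (simp add: norm_mult)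
  finally show ?thesis by (simp add: inv_fourier_def norm_mult norm_divide divide_right_mono)
qed

text \<open>Fubini, together with the splitting of \<open>exp (\<i> * (x - t) * u)\<close> into an
  \<open>x\<close> factor and a \<open>t\<close> factor, makes the inner integral
  \<open>fourier h u\<close>. Through this identity, convolutions of functions with disjoint spectra
  vanish.\<close>

lemma conv_inv_fourier:
  assumes \<tau>: "integrable lborel \<tau>" and h: "integrable lborel h"
  shows "conv (inv_fourier \<tau>) h x = inv_fourier (\<lambda>u. \<tau> u * fourier h u) x"
proof -
  let ?k = "\<lambda>t u. complex_of_real (1 / (2 * pi)) * exp (\<i> * of_real ((x - t) * u))"
  have swap: "(\<integral>t. \<integral>u. h t * \<tau> (u - 0 * t) * ?k t u \<partial>lborel \<partial>lborel) =
      (\<integral>u. \<integral>t. h t * \<tau> (u - 0 * t) * ?k t u \<partial>lborel \<partial>lborel)"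
  proof (rule integral_sheared_swap[OF h \<tau>])
    show "(\<lambda>(t, u). ?k t u) \<in> borel_measurable (borel \<Otimes>\<^sub>M borel)"
      unfolding borel_prod split_beta by (intro borel_measurable_continuous_onI continuous_intros)
    show "norm (?k t u) \<le> 1 / (2 * pi)" for t u by (simp add: norm_mult norm_divide)
  qed
  have "conv (inv_fourier \<tau>) h x = (\<integral>t. \<integral>u. h t * \<tau> (u - 0 * t) * ?k t u \<partial>lborel \<partial>lborel)"
    unfolding conv_def inv_fourier_def
    by (simp add: mult_ac flip: integral_mult_right_zero integral_mult_left_zero)
  also have "\<dots> = (\<integral>u. complex_of_real (1 / (2 * pi)) * (\<tau> u * fourier h u * exp (\<i> * of_real (x * u))) \<partial>lborel)"
    unfolding swap
  proof (rule Bochner_Integration.integral_cong[OF refl])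
    fix u
    have "exp (\<i> * complex_of_real ((x - t) * u)) = exp (\<i> * of_real (x * u)) * exp (- \<i> * of_real (t * u))" for t
      by (simp add: exp_add[symmetric] algebra_simps)
    then show "(\<integral>t. h t * \<tau> (u - 0 * t) * ?k t u \<partial>lborel) =
        complex_of_real (1 / (2 * pi)) * (\<tau> u * fourier h u * exp (\<i> * of_real (x * u)))"
      by (simp add: fourier_def mult_ac flip: integral_mult_right_zero)
  qed
  finally show ?thesis by (simp add: inv_fourier_def)
qed

text \<open>Abel summation: with the factor \<open>exp (- y * \<bar>t\<bar>)\<close> inserted,
  Fubini turns the integral into the Poisson integral of \<open>\<tau>\<close> at
  \<open>Complex s y\<close>. As \<open>y\<close> tends to 0, that tends to \<open>\<tau> s\<close>,
  while dominated convergence removes the factor on the other side.\<close>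

theorem fourier_inv_fourier:
  assumes \<tau>: "integrable lborel \<tau>" "continuous_on UNIV \<tau>" "\<And>u. norm (\<tau> u) \<le> M"
    and int: "integrable lborel (inv_fourier \<tau>)"
  shows "fourier (inv_fourier \<tau>) s = \<tau> s"
proof -
  let ?y = "\<lambda>n. inverse (real (Suc n))"
  let ?J = "\<lambda>n. \<integral>t. inv_fourier \<tau> t * exp (- \<i> * of_real (t * s)) * of_real (exp (- (?y n * \<bar>t\<bar>))) \<partial>lborel"
  have m1 [measurable]: "inv_fourier \<tau> \<in> borel_measurable borel" using borel_measurable_integrable[OF int] by simp
  have m2 [measurable]: "(\<lambda>t. exp (- \<i> * complex_of_real (t * s))) \<in> borel_measurable borel"
    by (intro borel_measurable_continuous_onI continuous_intros)
  have "?J \<longlonglongrightarrow> (\<integral>t. inv_fourier \<tau> t * exp (- \<i> * of_real (t * s)) * of_real (exp (- (0 * \<bar>t\<bar>))) \<partial>lborel)"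
  proof (rule integral_dominated_convergence[where w = "\<lambda>t. norm (inv_fourier \<tau> t)"])
    show "AE t in lborel. (\<lambda>n. inv_fourier \<tau> t * exp (- \<i> * of_real (t * s)) * of_real (exp (- (?y n * \<bar>t\<bar>))))
       \<longlonglongrightarrow> inv_fourier \<tau> t * exp (- \<i> * of_real (t * s)) * of_real (exp (- (0 * \<bar>t\<bar>)))"
      by (intro AE_I2 tendsto_intros LIMSEQ_inverse_real_of_nat)
    show "AE t in lborel. norm (inv_fourier \<tau> t * exp (- \<i> * of_real (t * s)) * of_real (exp (- (?y n * \<bar>t\<bar>))))
       \<le> norm (inv_fourier \<tau> t)" for n
      by (intro AE_I2) (simp add: norm_mult mult_left_le)
    show "(\<lambda>t. inv_fourier \<tau> t * exp (- \<i> * of_real (t * s)) * of_real (exp (- (?y n * \<bar>t\<bar>)))) \<in> borel_measurable lborel" for n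
      by measurable
    show "(\<lambda>t. inv_fourier \<tau> t * exp (- \<i> * of_real (t * s)) * of_real (exp (- (0 * \<bar>t\<bar>)))) \<in> borel_measurable lborel"
      by measurable
  qed (use int in simp)
  then have lim: "?J \<longlonglongrightarrow> fourier (inv_fourier \<tau>) s"
    by (simp add: fourier_def)
  have "?J n = poisson \<tau> (Complex s (?y n))" for n
  proof -
    define y where "y = ?y n"
    have y: "y > 0" by (simp add: y_def)
    let ?k = "\<lambda>t u. complex_of_real (1 / (2 * pi)) * exp (\<i> * of_real (t * (u - s)))"
    let ?a = "\<lambda>t. complex_of_real (exp (- (y * \<bar>t\<bar>)))"
    have a: "integrable lborel ?a"
      using has_bochner_integral_exp_abs[OF y, of 0] by (simp add: has_bochner_integral_iff)
    have swap: "(\<integral>t. \<integral>u. ?a t * \<tau> (u - 0 * t) * ?k t u \<partial>lborel \<partial>lborel) =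
        (\<integral>u. \<integral>t. ?a t * \<tau> (u - 0 * t) * ?k t u \<partial>lborel \<partial>lborel)"
    proof (rule integral_sheared_swap[OF a \<tau>(1)])
      show "(\<lambda>(t, u). ?k t u) \<in> borel_measurable (borel \<Otimes>\<^sub>M borel)"
        unfolding borel_prod split_beta by (intro borel_measurable_continuous_onI continuous_intros)
      show "norm (?k t u) \<le> 1 / (2 * pi)" for t u by (simp add: norm_mult norm_divide)
    qed
    have "exp (\<i> * complex_of_real (t * (u - s))) = exp (\<i> * of_real (t * u)) * exp (- \<i> * of_real (t * s))" for t u
      by (simp add: exp_add[symmetric] algebra_simps)
    then have "?J n = (\<integral>t. \<integral>u. ?a t * \<tau> (u - 0 * t) * ?k t u \<partial>lborel \<partial>lborel)"
      unfolding inv_fourier_def y_def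
      by (simp add: mult_ac flip: integral_mult_right_zero integral_mult_left_zero)
    also have "\<dots> = (\<integral>u. \<tau> u * of_real (y / (pi * ((s - u)\<^sup>2 + y\<^sup>2))) \<partial>lborel)"
      unfolding swap
    proof (rule Bochner_Integration.integral_cong[OF refl])
      fix u
      have "(\<integral>t. ?a t * \<tau> (u - 0 * t) * ?k t u \<partial>lborel) =
          \<tau> u * of_real (1 / (2 * pi)) * (\<integral>t. ?a t * exp (\<i> * of_real (t * (u - s))) \<partial>lborel)"
        by (simp add: mult_ac flip: integral_mult_right_zero)
      also have "(\<integral>t. ?a t * exp (\<i> * of_real (t * (u - s))) \<partial>lborel) = of_real (2 * y / (y\<^sup>2 + (u - s)\<^sup>2))"
        by (rule has_bochner_integral_integral_eq[OF has_bochner_integral_exp_abs[OF y]])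
      also have "\<tau> u * of_real (1 / (2 * pi)) * of_real (2 * y / (y\<^sup>2 + (u - s)\<^sup>2)) =
          \<tau> u * complex_of_real (1 / (2 * pi) * (2 * y / (y\<^sup>2 + (u - s)\<^sup>2)))"
        by (simp only: of_real_mult mult.assoc)
      also have "1 / (2 * pi) * (2 * y / (y\<^sup>2 + (u - s)\<^sup>2)) = y / (pi * ((s - u)\<^sup>2 + y\<^sup>2))"
        by (simp add: power2_commute add.commute)
      finally show "(\<integral>t. ?a t * \<tau> (u - 0 * t) * ?k t u \<partial>lborel) =
          \<tau> u * of_real (y / (pi * ((s - u)\<^sup>2 + y\<^sup>2)))" .
    qed
    finally show ?thesis by (simp add: poisson_def y_def)
  qed
  then have "?J \<longlonglongrightarrow> \<tau> s" using poisson_tendsto[OF \<tau>(2,3)] by simp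
  then show ?thesis using lim LIMSEQ_unique by blast
qed

section \<open>Integrability of inverse Fourier transforms\<close>

lemma integrable_continuous_compact_support:
  fixes f :: "real \<Rightarrow> 'a :: euclidean_space"
  assumes "continuous_on UNIV f" "\<And>x. x \<notin> {a..b} \<Longrightarrow> f x = 0"
  shows "integrable lborel f"
proof -
  have "set_integrable lborel {a..b} f"
    using continuous_on_subset[OF assms(1)] by (intro borel_integrable_atLeastAtMost') auto
  moreover have "(\<lambda>x. indicator {a..b} x *\<^sub>R f x) = f"
    using assms(2) by (auto simp: fun_eq_iff indicator_def)
  ultimately show ?thesis by (simp add: set_integrable_def)
qed

lemma integrable_cauchy_decay:
  fixes f :: "real \<Rightarrow> complex"
  assumes "continuous_on UNIV f" "\<And>x. norm (f x) \<le> C / (1 + x\<^sup>2)"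
  shows "integrable lborel f"
proof (rule Bochner_Integration.integrable_bound)
  show "integrable lborel (\<lambda>x. C * (1 / (1 + x\<^sup>2)))"
    by (rule integrable_mult_right[OF integrable_inverse_1_plus_square_lborel])
  show "f \<in> borel_measurable lborel"
    using borel_measurable_continuous_onI[OF assms(1)] by simp
  show "AE x in lborel. norm (f x) \<le> norm (C * (1 / (1 + x\<^sup>2)))"
    using order_trans[OF assms(2) abs_ge_self] by (intro AE_I2) simp
qed

lemma cauchy_decayI:
  fixes y :: "'a :: real_normed_vector"
  assumes "norm y \<le> A" "x\<^sup>2 * norm y \<le> B"
  shows "norm y \<le> (A + B) / (1 + x\<^sup>2)"
proof -
  have "norm y * (1 + x\<^sup>2) \<le> A + B" using assms by (simp add: algebra_simps)
  then show ?thesis by (simp add: le_divide_eq add_pos_nonneg)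
qed

lemma has_vector_derivative_imp_continuous_on:
  assumes "\<And>u. (g has_vector_derivative g' u) (at u)"
  shows "continuous_on UNIV g"
  by (intro continuous_at_imp_continuous_on ballI has_vector_derivative_continuous[OF assms])

lemma exp_i_has_vector_derivative:
  "((\<lambda>u. exp (\<i> * complex_of_real (x * u))) has_vector_derivative
    \<i> * of_real x * exp (\<i> * of_real (x * u))) (at u)"
proof -
  have "((\<lambda>z. exp (\<i> * of_real x * z)) has_field_derivative \<i> * of_real x * exp (\<i> * of_real x * of_real u))
      (at (of_real u))"
    by (auto intro!: derivative_eq_intros)
  from has_vector_derivative_real_field[OF this] show ?thesis by (simp add: mult.assoc)
qed

text \<open>Integration by parts: the derivative of \<open>g u * exp (\<i> * x * u)\<close> has
  integral zero because \<open>g\<close> has compact support.\<close>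

lemma inv_fourier_derivative:
  fixes g g' :: "real \<Rightarrow> complex"
  assumes D: "\<And>u. (g has_vector_derivative g' u) (at u)" and cont: "continuous_on UNIV g'"
    and zero: "\<And>u. u \<notin> {a..b} \<Longrightarrow> g u = 0" "\<And>u. u \<notin> {a..b} \<Longrightarrow> g' u = 0"
    and ab: "a \<le> b"
  shows "inv_fourier g' x = - \<i> * of_real x * inv_fourier g x"
proof -
  have cg: "continuous_on UNIV g"
    by (rule has_vector_derivative_imp_continuous_on[OF D])
  let ?e = "\<lambda>u. exp (\<i> * complex_of_real (x * u))"
  let ?h = "\<lambda>u. g' u * ?e u + \<i> * of_real x * (g u * ?e u)"
  have hd: "((\<lambda>u. g u * ?e u) has_vector_derivative ?h u) (at u)" for u
  proof -
    from has_vector_derivative_mult[OF D exp_i_has_vector_derivative[of x u]] show ?thesis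
      by (simp add: algebra_simps)
  qed
  \<comment> \<open>The interval is widened by 1 on each side, because \<open>g\<close> is assumed
    to vanish only outside the closed interval and the boundary terms have to be zero.\<close>
  have "(\<integral>u. indicator {a - 1..b + 1} u *\<^sub>R ?h u \<partial>lborel) = g (b + 1) * ?e (b + 1) - g (a - 1) * ?e (a - 1)"
    by (rule integral_FTC_atLeastAtMost[OF _ has_vector_derivative_at_within[OF hd]])
       (use ab in simp, intro continuous_intros continuous_on_subset[OF cont subset_UNIV]
          continuous_on_subset[OF cg subset_UNIV])
  moreover have "(\<lambda>u. indicator {a - 1..b + 1} u *\<^sub>R ?h u) = ?h"
  proof
    fix u
    show "indicator {a - 1..b + 1} u *\<^sub>R ?h u = ?h u"
    proof (cases "u \<in> {a - 1..b + 1}")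
      case False
      then have "g u = 0" "g' u = 0" using zero[of u] by auto
      then show ?thesis by (simp only: mult_zero_left mult_zero_right add_0 scaleR_zero_right)
    qed (simp only: indicator_simps scaleR_one)
  qed
  ultimately have "(\<integral>u. ?h u \<partial>lborel) = 0" using zero(1)[of "a - 1"] zero(1)[of "b + 1"] by simp
  moreover have "integrable lborel (\<lambda>u. g' u * ?e u)" "integrable lborel (\<lambda>u. g u * ?e u)"
    by (rule integrable_continuous_compact_support[of _ a b],
        intro continuous_intros cont cg, simp add: zero)+
  ultimately have "(\<integral>u. g' u * ?e u \<partial>lborel) = - \<i> * of_real x * (\<integral>u. g u * ?e u \<partial>lborel)"
    by (simp add: add_eq_0_iff2)
  then show ?thesis by (simp add: inv_fourier_def)
qed

text \<open>Two integrations by parts bound \<open>x^2 * norm (inv_fourier g x)\<close>. With the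
  trivial bound near the origin this gives decay of order \<open>1 / (1 + x^2)\<close>.\<close>

lemma integrable_inv_fourier_C2:
  fixes g g' g'' :: "real \<Rightarrow> complex"
  assumes D: "\<And>u. (g has_vector_derivative g' u) (at u)" "\<And>u. (g' has_vector_derivative g'' u) (at u)"
    and cont: "continuous_on UNIV g''"
    and zero: "\<And>u. u \<notin> {a..b} \<Longrightarrow> g u = 0" "\<And>u. u \<notin> {a..b} \<Longrightarrow> g' u = 0" "\<And>u. u \<notin> {a..b} \<Longrightarrow> g'' u = 0"
    and ab: "a \<le> b"
  shows "integrable lborel (inv_fourier g)"
proof (rule integrable_cauchy_decay)
  have cg: "continuous_on UNIV g" "continuous_on UNIV g'"
    by (rule has_vector_derivative_imp_continuous_on, rule D)+
  show "continuous_on UNIV (inv_fourier g)"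
    using cg zero by (intro continuous_on_inv_fourier integrable_continuous_compact_support[of _ a b])
  fix x
  have "inv_fourier g'' x = - \<i> * of_real x * (- \<i> * of_real x * inv_fourier g x)"
    using inv_fourier_derivative[OF D(1) cg(2) zero(1,2) ab, of x]
      inv_fourier_derivative[OF D(2) cont zero(2,3) ab, of x] by simp
  then have "norm (inv_fourier g'' x) = x\<^sup>2 * norm (inv_fourier g x)"
    by (simp add: norm_mult power2_eq_square)
  then show "norm (inv_fourier g x) \<le>
      ((\<integral>u. norm (g u) \<partial>lborel) / (2 * pi) + (\<integral>u. norm (g'' u) \<partial>lborel) / (2 * pi)) / (1 + x\<^sup>2)"
    using norm_inv_fourier_le[of g x] norm_inv_fourier_le[of g'' x] by (intro cauchy_decayI) simp_all
qed

section \<open>Littlewood-Paley kernels\<close>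

abbreviation psi :: "int \<Rightarrow> real \<Rightarrow> complex" where
  "psi k \<equiv> \<lambda>u. complex_of_real (besov_psi (2 powr (- real_of_int k) * u))"

lemma phi_eq_inv_fourier: "phi k = inv_fourier (psi k)"
  by (simp add: fun_eq_iff phi_def inv_fourier_def)

lemma besov_psi_support: "besov_psi t \<noteq> 0 \<Longrightarrow> 1 / 2 \<le> t \<and> t \<le> 2"
  using admissible_besov_psi closure_subset[of "{t. besov_psi t \<noteq> 0}"]
  unfolding admissible_def by fastforce

lemma besov_psi_deriv:
  "((deriv ^^ n) besov_psi has_real_derivative (deriv ^^ Suc n) besov_psi x) (at x)"
proof -
  have "(deriv ^^ n) besov_psi differentiable (at x)"
    using admissible_besov_psi by (auto simp: admissible_def schwartz_def)
  then show ?thesis by (metis DERIV_imp_deriv comp_apply funpow.simps(2) real_differentiable_def)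
qed

lemma
  shows integrable_psi: "integrable lborel (psi k)"
    and integrable_phi: "integrable lborel (phi k)"
proof -
  define c :: real where "c = 2 powr (- real_of_int k)"
  have c: "c > 0" by (simp add: c_def)
  \<comment> \<open>The \<open>n\<close>-th derivative of the dilated cutoff, by the chain rule.
    Orders 0, 1 and 2 feed the decay estimate for two derivatives.\<close>
  let ?g = "\<lambda>n u. complex_of_real (c ^ n * (deriv ^^ n) besov_psi (c * u))"
  have D: "(?g n has_vector_derivative ?g (Suc n) u) (at u)" for n u
  proof -
    have "((\<lambda>u. c * u) has_real_derivative c) (at u)" by (auto intro!: derivative_eq_intros)
    from DERIV_cmult[OF DERIV_chain2[OF besov_psi_deriv this], of "c ^ n" n]
    have "((\<lambda>u. c ^ n * (deriv ^^ n) besov_psi (c * u)) has_real_derivative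
      c ^ Suc n * (deriv ^^ Suc n) besov_psi (c * u)) (at u)" by (simp add: mult_ac)
    then show ?thesis
      by (intro has_vector_derivative_of_real) (simp add: has_real_derivative_iff_has_vector_derivative)
  qed
  have cont: "continuous_on UNIV (?g n)" for n
    by (rule has_vector_derivative_imp_continuous_on[OF D])
  have zero: "?g n u = 0" if "u \<notin> {0..2 / c}" for n u
  proof -
    have "c * u \<notin> {0..2}" using that c by (auto simp: field_simps zero_le_mult_iff)
    then have "(deriv ^^ n) besov_psi (c * u) = 0"
      using besov_psi_support by (intro funpow_deriv_eq_0_outside[of "{0..2}"]) force+
    then show ?thesis by simp
  qed
  show "integrable lborel (psi k)"
    using integrable_continuous_compact_support[OF cont[of 0] zero] by (simp add: c_def)
  have "integrable lborel (inv_fourier (?g 0))"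
    by (rule integrable_inv_fourier_C2[OF D D cont zero zero zero]) (use c in auto)
  then show "integrable lborel (phi k)"
    by (simp add: phi_eq_inv_fourier c_def)
qed

section \<open>The tent function and the Fejer kernel\<close>

definition tent :: "real \<Rightarrow> complex" where
  "tent u = of_real (max 0 (1 - \<bar>u\<bar>))"

lemma continuous_on_tent [continuous_intros]: "continuous_on S g \<Longrightarrow> continuous_on S (\<lambda>x. tent (g x))"
  unfolding tent_def by (intro continuous_intros)

lemma tent_0 [simp]: "tent 0 = 1"
  by (simp add: tent_def)

lemma tent_eq_0: "1 \<le> \<bar>u\<bar> \<Longrightarrow> tent u = 0"
  by (simp add: tent_def)

lemma norm_tent_le: "norm (tent u) \<le> 1"
  by (simp add: tent_def)

lemma integrable_tent: "integrable lborel (\<lambda>u. tent (u - l))"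
  by (rule integrable_continuous_compact_support[where a = "l - 1" and b = "l + 1"])
     (auto intro!: continuous_intros tent_eq_0)

text \<open>The Fejer kernel modulated to frequency \<open>l\<close>. Defining it through its
  spectrum makes the convolution identity for \<open>inv_fourier\<close> apply directly. The
  \<open>g\<^sub>k\<close> of the overview is \<open>atom (freq k)\<close>.\<close>

definition atom :: "real \<Rightarrow> real \<Rightarrow> complex" where
  "atom l = inv_fourier (\<lambda>u. tent (u - l))"

lemma atom_eq: "atom l x = exp (\<i> * of_real (x * l)) * atom 0 x"
proof -
  have "(\<integral>u. tent (u - l) * exp (\<i> * of_real (x * u)) \<partial>lborel) =
      (\<integral>u. tent (u - l) * exp (\<i> * of_real (x * (u - l + l))) \<partial>lborel)"
    by simp
  also have "\<dots> = (\<integral>u. tent u * exp (\<i> * of_real (x * (u + l))) \<partial>lborel)"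
    using lborel_integral_shift[of "\<lambda>u. tent u * exp (\<i> * of_real (x * (u + l)))" l] by simp
  also have "\<dots> = (\<integral>u. exp (\<i> * of_real (x * l)) * (tent u * exp (\<i> * of_real (x * u))) \<partial>lborel)"
    by (simp add: algebra_simps exp_add)
  finally show ?thesis by (simp add: atom_def inv_fourier_def)
qed

text \<open>The closed form shows that the kernel is real and nonnegative off the origin, which the
  L1 estimate of sums of atoms relies on. The tent is split at 0 into two half tents, each
  integrated by an explicit antiderivative.\<close>

lemma atom_0_eq:
  assumes "x \<noteq> 0"
  shows "atom 0 x = of_real ((1 - cos x) / (pi * x\<^sup>2))"
proof -
  let ?e = "\<lambda>y u. exp (\<i> * complex_of_real (y * u))"
  let ?G = "\<lambda>y u. indicator {0..1} u *\<^sub>R (of_real (1 - u) * ?e y u)"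
  have int: "integrable lborel (?G y)" for y
    unfolding set_integrable_def[symmetric]
    by (intro borel_integrable_atLeastAtMost' continuous_intros)
  have G: "(\<integral>u. ?G y u \<partial>lborel) = - exp (\<i> * of_real y) / of_real (y\<^sup>2) + 1 / of_real (y\<^sup>2) + \<i> / of_real y"
    if y: "y \<noteq> 0" for y
  proof -
    define w where "w = \<i> * complex_of_real y"
    have w: "w \<noteq> 0" "w * w = - of_real (y\<^sup>2)" "1 / w = - \<i> / of_real y"
      using y by (auto simp: w_def power2_eq_square field_simps)
    \<comment> \<open>The antiderivative found by integrating \<open>(1 - u) * exp (w * u)\<close>
      by parts once.\<close>
    let ?F = "\<lambda>u. of_real (1 - u) * ?e y u / w + ?e y u / (w * w)"
    have FD: "(?F has_vector_derivative of_real (1 - u) * ?e y u) (at u)" for u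
    proof -
      have "((\<lambda>u. complex_of_real (1 - u)) has_vector_derivative - 1) (at u)"
        using has_vector_derivative_of_real[of "\<lambda>u. 1 - u" "- 1" "at u"]
        by (auto intro!: derivative_eq_intros simp flip: has_real_derivative_iff_has_vector_derivative)
      then have "(?F has_vector_derivative
          (of_real (1 - u) * (w * ?e y u) + - 1 * ?e y u) / w + w * ?e y u / (w * w)) (at u)"
        using exp_i_has_vector_derivative[of y u] unfolding w_def
        by (intro has_vector_derivative_add has_vector_derivative_divide has_vector_derivative_mult)
      also have "(of_real (1 - u) * (w * ?e y u) + - 1 * ?e y u) / w + w * ?e y u / (w * w) = of_real (1 - u) * ?e y u"
        using w(1) by (simp add: diff_divide_distrib)
      finally show ?thesis .
    qed
    have "(\<integral>u. ?G y u \<partial>lborel) = ?F 1 - ?F 0"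
      by (rule integral_FTC_atLeastAtMost[OF _ has_vector_derivative_at_within[OF FD]])
         (simp, intro continuous_intros)
    also have "\<dots> = exp (\<i> * of_real y) / (w * w) - 1 / w - 1 / (w * w)"
    proof -
      have "?e y 1 = exp (\<i> * of_real y)" "?e y 0 = 1"
        by (simp_all only: mult_1_right mult_zero_right of_real_0 exp_zero)
      then show ?thesis
        by (simp only: diff_self of_real_0 mult_zero_left div_0 add_0 diff_zero of_real_1 mult_1_left diff_diff_eq)
    qed
    also have "\<dots> = - exp (\<i> * of_real y) / of_real (y\<^sup>2) + 1 / of_real (y\<^sup>2) + \<i> / of_real y"
      unfolding w(2,3) by (simp add: minus_divide_right[symmetric])
    finally show ?thesis .
  qed
  \<comment> \<open>The left half of the tent is the reflection of the right half with
    \<open>x\<close> negated. Both halves contain \<open>u = 0\<close>, hence equality only almost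
    everywhere.\<close>
  have "(\<integral>u. tent u * ?e x u \<partial>lborel) = (\<integral>u. ?G x u + ?G (- x) (- u) \<partial>lborel)"
  proof (rule integral_cong_AE)
    show "AE u in lborel. tent u * ?e x u = ?G x u + ?G (- x) (- u)"
      by (intro eventually_mono[OF AE_lborel_singleton[of 0]]) (auto simp: indicator_def tent_def)
    show "(\<lambda>u. tent u * ?e x u) \<in> borel_measurable lborel"
      by (intro borel_measurable_lborel_continuous continuous_intros)
    show "(\<lambda>u. ?G x u + ?G (- x) (- u)) \<in> borel_measurable lborel"
      using borel_measurable_integrable[OF int]
      by (intro borel_measurable_add measurable_compose[OF _ borel_measurable_integrable[OF int]]) auto
  qed
  also have "\<dots> = (\<integral>u. ?G x u \<partial>lborel) + (\<integral>u. ?G (- x) (- u) \<partial>lborel)"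
    using lborel_integrable_real_affine[OF int[of "- x"], of "- 1" 0]
    by (intro Bochner_Integration.integral_add int) simp
  also have "(\<integral>u. ?G (- x) (- u) \<partial>lborel) = (\<integral>u. ?G (- x) u \<partial>lborel)"
    using lborel_integral_real_affine[of "- 1" "?G (- x)" 0] by simp
  \<comment> \<open>The terms \<open>\<i> / y\<close> for \<open>y = x\<close> and
    \<open>y = - x\<close> cancel, and the two exponentials combine to a cosine.\<close>
  also have "(\<integral>u. ?G x u \<partial>lborel) + (\<integral>u. ?G (- x) u \<partial>lborel) =
      (2 - (exp (\<i> * of_real x) + exp (- (\<i> * of_real x)))) / of_real (x\<^sup>2)"
    using assms by (subst (1 2) G) (simp_all add: field_simps)
  also have "exp (\<i> * of_real x) + exp (- (\<i> * of_real x)) = of_real (2 * cos x)"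
    by (simp add: cos_exp_eq cos_of_real[symmetric])
  finally show ?thesis
    using assms by (simp add: atom_def inv_fourier_def field_simps)
qed

section \<open>Convolution and sup norms\<close>

lemma supnorm_upper: "bounded (range f) \<Longrightarrow> norm (f x) \<le> supnorm f"
  unfolding supnorm_def by (rule cSUP_upper) (auto simp: bounded_iff intro: bdd_aboveI2)

lemma supnorm_least: "(\<And>x. norm (f x) \<le> B) \<Longrightarrow> supnorm f \<le> B"
  unfolding supnorm_def by (rule cSUP_least) auto

lemma L1norm_nonneg: "0 \<le> L1norm h"
  by (simp add: L1norm_def)

lemma integrable_conv_integrand:
  fixes F h :: "real \<Rightarrow> complex"
  assumes F: "F \<in> borel_measurable borel" "\<And>t. norm (F t) \<le> M" and h: "integrable lborel h"
  shows "integrable lborel (\<lambda>t. F (x - t) * h t)"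
proof (rule Bochner_Integration.integrable_bound)
  have [measurable]: "F \<in> borel_measurable borel" "h \<in> borel_measurable borel"
    using F borel_measurable_integrable[OF h] by simp_all
  show "integrable lborel (\<lambda>t. M * norm (h t))" using h by simp
  show "(\<lambda>t. F (x - t) * h t) \<in> borel_measurable lborel" by measurable
  show "AE t in lborel. norm (F (x - t) * h t) \<le> norm (M * norm (h t))"
    using order_trans[OF F(2) abs_ge_self] by (intro AE_I2) (simp add: norm_mult abs_mult mult_right_mono)
qed

lemma norm_conv_le:
  assumes F: "\<And>t. norm (F t) \<le> M" and h: "integrable lborel h"
  shows "norm (conv F h x) \<le> M * L1norm h"
proof -
  have "norm (conv F h x) \<le> (\<integral>t. norm (F (x - t) * h t) \<partial>lborel)"
    unfolding conv_def by (rule integral_norm_bound)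
  also have "\<dots> \<le> (\<integral>t. M * norm (h t) \<partial>lborel)"
    using h F order_trans[OF norm_ge_zero F]
    by (intro integral_mono') (auto simp: norm_mult intro: mult_right_mono)
  finally show ?thesis by (simp add: L1norm_def)
qed

lemma borel_measurable_conv:
  assumes F: "F \<in> borel_measurable borel" and h: "h \<in> borel_measurable borel"
  shows "conv F h \<in> borel_measurable borel"
proof -
  have [measurable]: "F \<in> borel_measurable borel" "h \<in> borel_measurable borel" using assms by auto
  show ?thesis unfolding conv_def by measurable
qed

lemma conv_sum_left:
  assumes "\<And>i. i \<in> I \<Longrightarrow> integrable lborel (\<lambda>t. F i (x - t) * h t)"
  shows "conv (\<lambda>y. \<Sum>i\<in>I. F i y) h x = (\<Sum>i\<in>I. conv (F i) h x)"
  unfolding conv_def sum_distrib_right using assms by (rule Bochner_Integration.integral_sum)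

lemma conv_sum_right:
  assumes "\<And>i. i \<in> I \<Longrightarrow> integrable lborel (\<lambda>t. F (x - t) * h i t)"
  shows "conv F (\<lambda>t. \<Sum>i\<in>I. h i t) x = (\<Sum>i\<in>I. conv F (h i) x)"
  unfolding conv_def sum_distrib_left using assms by (rule Bochner_Integration.integral_sum)

text \<open>Translating the inner variable by \<open>t\<close> shifts the argument of
  \<open>f\<close> instead of that of \<open>F\<close>; then Fubini for the shear with
  \<open>c = 1\<close> applies.\<close>

lemma conv_conv:
  assumes F: "F \<in> borel_measurable borel" "\<And>t. norm (F t) \<le> M"
    and f: "integrable lborel f" and g: "integrable lborel g"
  shows "conv (conv F f) g x = conv F (conv f g) x"
proof -
  have "conv (conv F f) g x = (\<integral>t. (\<integral>s. F (x - t - s) * f s \<partial>lborel) * g t \<partial>lborel)"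
    by (simp add: conv_def)
  also have "\<dots> = (\<integral>t. (\<integral>v. F (x - v) * f (v - t) \<partial>lborel) * g t \<partial>lborel)"
  proof -
    have "(\<integral>s. F (x - t - s) * f s \<partial>lborel) = (\<integral>v. F (x - v) * f (v - t) \<partial>lborel)" for t
      using lborel_integral_shift[of "\<lambda>s. F (x - t - s) * f s" t] by simp
    then show ?thesis by simp
  qed
  also have "\<dots> = (\<integral>t. \<integral>v. g t * f (v - 1 * t) * F (x - v) \<partial>lborel \<partial>lborel)"
    by (simp add: mult_ac flip: integral_mult_right_zero)
  also have "\<dots> = (\<integral>v. \<integral>t. g t * f (v - 1 * t) * F (x - v) \<partial>lborel \<partial>lborel)"
    using F by (intro integral_sheared_swap[OF g f, where M = M]) auto
  also have "\<dots> = conv F (conv f g) x"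
    by (simp add: conv_def mult_ac flip: integral_mult_right_zero)
  finally show ?thesis .
qed

text \<open>The bound must not depend on \<open>I\<close> or \<open>t\<close>. On each side of
  \<open>t\<close> the indices map injectively to integers not exceeding their distance from
  \<open>t\<close>, so each side is at most the full series of \<open>1 / (1 + i^2)\<close>.\<close>

lemma sum_cauchy_weights_bounded:
  "\<exists>K::real. \<forall>I t. finite I \<longrightarrow> (\<Sum>k\<in>I. 1 / (1 + (t - real k)\<^sup>2)) \<le> K"
proof (intro exI allI impI)
  fix I :: "nat set" and t :: real
  assume I: "finite I"
  let ?c = "\<lambda>i::nat. 1 / (1 + (real i)\<^sup>2)"
  have sm: "summable ?c"
  proof (rule summable_comparison_test[OF exI[of _ 1]])
    show "summable (\<lambda>i. inverse ((real i)\<^sup>2))" by (rule inverse_power_summable) simp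
    show "\<forall>n\<ge>1. norm (?c n) \<le> inverse ((real n)\<^sup>2)"
      by (auto simp: inverse_eq_divide intro!: divide_left_mono add_pos_pos mult_pos_pos)
  qed
  have part: "(\<Sum>k\<in>J. 1 / (1 + (t - real k)\<^sup>2)) \<le> suminf ?c"
    if J: "J \<subseteq> I" "inj_on d J" "\<And>k. k \<in> J \<Longrightarrow> real (d k) \<le> \<bar>t - real k\<bar>" for J and d :: "nat \<Rightarrow> nat"
  proof -
    have "(\<Sum>k\<in>J. 1 / (1 + (t - real k)\<^sup>2)) \<le> (\<Sum>k\<in>J. ?c (d k))"
    proof (rule sum_mono)
      fix k assume "k \<in> J"
      then have "(real (d k))\<^sup>2 \<le> (t - real k)\<^sup>2" using J(3) by (simp add: abs_le_square_iff[symmetric])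
      then show "1 / (1 + (t - real k)\<^sup>2) \<le> ?c (d k)"
        by (intro divide_left_mono) (auto intro!: mult_pos_pos add_pos_nonneg)
    qed
    also have "\<dots> = (\<Sum>i\<in>d ` J. ?c i)" using J(2) by (simp add: sum.reindex)
    also have "\<dots> \<le> suminf ?c"
      using J(1) I sm by (intro sum_le_suminf) (auto intro: finite_subset)
    finally show ?thesis .
  qed
  have "(\<Sum>k\<in>I. 1 / (1 + (t - real k)\<^sup>2)) =
      (\<Sum>k\<in>{k\<in>I. real k \<le> t}. 1 / (1 + (t - real k)\<^sup>2)) + (\<Sum>k\<in>{k\<in>I. t < real k}. 1 / (1 + (t - real k)\<^sup>2))"
    using I by (subst sum.union_disjoint[symmetric]) (auto intro!: sum.cong)
  also have "\<dots> \<le> suminf ?c + suminf ?c"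
  proof (rule add_mono)
    have 1: "k \<le> nat \<lfloor>t\<rfloor>" if "real k \<le> t" for k using that by (simp add: le_nat_floor)
    show "(\<Sum>k\<in>{k\<in>I. real k \<le> t}. 1 / (1 + (t - real k)\<^sup>2)) \<le> suminf ?c"
    proof (rule part[where d = "\<lambda>k. nat \<lfloor>t\<rfloor> - k"])
      show "inj_on (\<lambda>k. nat \<lfloor>t\<rfloor> - k) {k \<in> I. real k \<le> t}" 
      proof (rule inj_onI)
        fix k l assume "k \<in> {k \<in> I. real k \<le> t}" "l \<in> {k \<in> I. real k \<le> t}" "nat \<lfloor>t\<rfloor> - k = nat \<lfloor>t\<rfloor> - l"
        then show "k = l" using 1[of k] 1[of l] by simp
      qed
      show "real (nat \<lfloor>t\<rfloor> - k) \<le> \<bar>t - real k\<bar>" if k: "k \<in> {k \<in> I. real k \<le> t}" for k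
      proof -
        have "real (nat \<lfloor>t\<rfloor>) \<le> t" using k of_nat_0_le_iff[of k] by (intro of_nat_floor) (auto intro: order_trans)
        then show ?thesis using k 1[of k] by (simp add: of_nat_diff)
      qed
    qed auto
    \<comment> \<open>For negative \<open>t\<close> the truncation makes
      \<open>nat \<lceil>t\<rceil>\<close> zero, and \<open>k\<close> itself is still at most its
      distance from \<open>t\<close>.\<close>
    have 2: "nat \<lceil>t\<rceil> \<le> k" if "t < real k" for k using that by linarith
    show "(\<Sum>k\<in>{k\<in>I. t < real k}. 1 / (1 + (t - real k)\<^sup>2)) \<le> suminf ?c"
    proof (rule part[where d = "\<lambda>k. k - nat \<lceil>t\<rceil>"])
      show "inj_on (\<lambda>k. k - nat \<lceil>t\<rceil>) {k \<in> I. t < real k}" using 2 by (auto intro!: inj_on_diff_nat)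
      show "real (k - nat \<lceil>t\<rceil>) \<le> \<bar>t - real k\<bar>" if k: "k \<in> {k \<in> I. t < real k}" for k
        using k 2[of k] of_nat_ceiling[of t] by (simp add: of_nat_diff)
    qed auto
  qed
  finally show "(\<Sum>k\<in>I. 1 / (1 + (t - real k)\<^sup>2)) \<le> suminf ?c + suminf ?c" .
qed

lemma C0R_subset_BUCR: "C0R \<subseteq> BUCR"
proof
  fix f :: "real \<Rightarrow> complex"
  assume "f \<in> C0R"
  then have cont: "continuous_on UNIV f" and lim: "(f \<longlongrightarrow> 0) at_infinity"
    by (auto simp: C0R_def)
  have small: "\<exists>R. \<forall>x. R \<le> \<bar>x\<bar> \<longrightarrow> norm (f x) < e" if "e > 0" for e
    using tendstoD[OF lim that] by (auto simp: eventually_at_infinity)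
  obtain R where R: "\<And>x. R \<le> \<bar>x\<bar> \<Longrightarrow> norm (f x) < 1" using small[of 1] by auto
  have "compact (f ` {- R..R})"
    by (intro compact_continuous_image continuous_on_subset[OF cont]) auto
  then obtain B where B: "\<And>x. x \<in> {- R..R} \<Longrightarrow> norm (f x) \<le> B"
    by (meson compact_imp_bounded bounded_iff imageI)
  have "norm (f x) \<le> max 1 B" for x
  proof (cases "R \<le> \<bar>x\<bar>")
    case True
    then show ?thesis using R[of x] by simp
  next
    case False
    then have "x \<in> {- R..R}" by auto
    then show ?thesis using B[of x] by simp
  qed
  then have bounded: "bounded (range f)" by (auto simp: bounded_iff)
  have "uniformly_continuous_on UNIV f"
    unfolding uniformly_continuous_on_def
  proof (intro allI impI)
    fix e :: real assume e: "e > 0"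
    then obtain R where R: "\<And>x. R \<le> \<bar>x\<bar> \<Longrightarrow> norm (f x) < e / 2" using small[of "e / 2"] by auto
    \<comment> \<open>The margin 1 ensures that two points closer than 1 either both lie in this
      interval or both have modulus at least \<open>R\<close>.\<close>
    have "uniformly_continuous_on {- R - 1..R + 1} f"
      by (intro compact_uniformly_continuous continuous_on_subset[OF cont]) auto
    then obtain d where d: "d > 0"
      "\<And>x y. x \<in> {- R - 1..R + 1} \<Longrightarrow> y \<in> {- R - 1..R + 1} \<Longrightarrow> dist y x < d \<Longrightarrow> dist (f y) (f x) < e"
      using e unfolding uniformly_continuous_on_def by meson
    have "dist (f y) (f x) < e" if "dist y x < min d 1" for x y
    proof (cases "x \<in> {- R - 1..R + 1} \<and> y \<in> {- R - 1..R + 1}")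
      case True
      then show ?thesis using d that by auto
    next
      case False
      then have "R \<le> \<bar>x\<bar>" "R \<le> \<bar>y\<bar>" using that by (auto simp: dist_real_def)
      then have "norm (f x) < e / 2" "norm (f y) < e / 2" using R by auto
      then show ?thesis unfolding dist_norm using norm_triangle_ineq4[of "f y" "f x"] by linarith
    qed
    then show "\<exists>d>0. \<forall>x\<in>UNIV. \<forall>x'\<in>UNIV. dist x' x < d \<longrightarrow> dist (f x') (f x) < e"
      using d(1) by (intro exI[of _ "min d 1"]) auto
  qed
  with bounded show "f \<in> BUCR" by (simp add: BUCR_def)
qed

section \<open>Modulated Fejer kernels\<close>

lemma continuous_on_atom: "continuous_on UNIV (atom l)"
  unfolding atom_def by (rule continuous_on_inv_fourier[OF integrable_tent])

lemma borel_measurable_atom [measurable]: "atom l \<in> borel_measurable borel"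
  by (rule borel_measurable_continuous_onI[OF continuous_on_atom])

lemma norm_atom: "norm (atom l x) = norm (atom 0 x)"
  by (subst atom_eq) (simp add: norm_mult)

text \<open>The modulus of an atom does not depend on its frequency, so the decay of the Fejer
  kernel holds uniformly in \<open>l\<close>.\<close>

lemma atom_decay: "\<exists>C. \<forall>l x. norm (atom l x) \<le> C / (1 + x\<^sup>2)"
proof (intro exI allI)
  fix l x
  have "x\<^sup>2 * norm (atom 0 x) \<le> 1"
  proof (cases "x = 0")
    case False
    have "norm (atom 0 x) = (1 - cos x) / (pi * x\<^sup>2)"
      unfolding atom_0_eq[OF False] norm_of_real by (rule abs_of_nonneg) simp
    then have "x\<^sup>2 * norm (atom 0 x) = (1 - cos x) / pi" using False by simp
    also have "\<dots> \<le> 2 / pi" using cos_ge_minus_one[of x] by (intro divide_right_mono) auto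
    also have "\<dots> \<le> 1" using pi_ge_two by simp
    finally show ?thesis .
  qed simp
  moreover have "norm (atom 0 x) \<le> (\<integral>u. norm (tent (u - 0)) \<partial>lborel) / (2 * pi)"
    unfolding atom_def by (rule norm_inv_fourier_le)
  ultimately show "norm (atom l x) \<le> ((\<integral>u. norm (tent (u - 0)) \<partial>lborel) / (2 * pi) + 1) / (1 + x\<^sup>2)"
    unfolding norm_atom[of l] by (intro cauchy_decayI)
qed

lemma norm_atom_bounded: "\<exists>C. \<forall>l x. norm (atom l x) \<le> C"
  using norm_inv_fourier_le[of "\<lambda>u. tent (u - 0)"] norm_atom unfolding atom_def by metis

lemma integrable_atom: "integrable lborel (atom l)"
  using atom_decay integrable_cauchy_decay[OF continuous_on_atom] by blast

lemma fourier_atom: "fourier (atom l) u = tent (u - l)"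
  unfolding atom_def
  by (rule fourier_inv_fourier[OF integrable_tent])
     (use integrable_atom norm_tent_le in \<open>auto intro!: continuous_intros simp flip: atom_def\<close>)

lemma integrable_mult_exp:
  fixes h :: "real \<Rightarrow> complex"
  assumes "integrable lborel h"
  shows "integrable lborel (\<lambda>t. h t * exp (- \<i> * of_real (t * u)))"
proof (rule Bochner_Integration.integrable_bound[OF assms])
  have [measurable]: "h \<in> borel_measurable borel" using borel_measurable_integrable[OF assms] by simp
  have [measurable]: "(\<lambda>t. exp (- \<i> * complex_of_real (t * u))) \<in> borel_measurable borel"
    by (intro borel_measurable_continuous_onI continuous_intros)
  show "(\<lambda>t. h t * exp (- \<i> * of_real (t * u))) \<in> borel_measurable lborel" by measurable
qed (simp add: norm_mult)

text \<open>The sum equals \<open>m x * atom 0 x\<close> with a trigonometric polynomial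
  \<open>m\<close>. The Fejer kernel is a probability density for which separated characters are
  orthonormal, so \<open>norm (m x) ^ 2\<close> has mean \<open>card I\<close>. The Cauchy-Schwarz
  bound on the mean of \<open>norm (m x)\<close> is obtained pointwise from
  \<open>2 * a \<le> a^2 / s + s\<close>.\<close>

lemma L1norm_sum_atoms_le:
  assumes I: "finite I" and sep: "\<And>j k. j \<in> I \<Longrightarrow> k \<in> I \<Longrightarrow> j \<noteq> k \<Longrightarrow> 1 \<le> \<bar>lam j - lam k\<bar>"
  shows "L1norm (\<lambda>x. \<Sum>k\<in>I. atom (lam k) x) \<le> sqrt (card I)"
proof (cases "I = {}")
  case True
  then show ?thesis by (simp add: L1norm_def)
next
  case False
  \<comment> \<open>This weight makes the two terms of the quadratic inequality contribute equally
    after integration.\<close>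
  define s where "s = sqrt (card I)"
  have s: "s > 0" "s * s = card I" using False I by (auto simp: s_def card_gt_0_iff)
  define m where "m = (\<lambda>x. \<Sum>k\<in>I. exp (\<i> * complex_of_real (x * lam k)))"
  \<comment> \<open>Pointwise \<open>P\<close> is \<open>m x * cnj (m x) * atom 0 x\<close>.
    Expanded as a double sum, its integral is a sum of values
    \<open>fourier (atom (lam j)) (lam k)\<close>, of which only the diagonal ones are
    nonzero.\<close>
  define P where "P = (\<lambda>x. \<Sum>j\<in>I. \<Sum>k\<in>I. atom (lam j) x * exp (- \<i> * complex_of_real (x * lam k)))"
  let ?h = "\<lambda>x. \<Sum>k\<in>I. atom (lam k) x"
  have h: "?h x = m x * atom 0 x" for x
    unfolding m_def sum_distrib_right by (intro sum.cong refl atom_eq)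
  have P: "P x = ?h x * cnj (m x)" for x
    by (simp add: P_def m_def sum_product exp_cnj)
  have intP: "integrable lborel P"
    unfolding P_def by (intro Bochner_Integration.integrable_sum integrable_mult_exp integrable_atom)
  have "(\<integral>x. P x \<partial>lborel) = (\<Sum>j\<in>I. \<Sum>k\<in>I. fourier (atom (lam j)) (lam k))"
    unfolding P_def fourier_def
    by (subst Bochner_Integration.integral_sum, intro Bochner_Integration.integrable_sum integrable_mult_exp integrable_atom,
        subst Bochner_Integration.integral_sum, intro integrable_mult_exp integrable_atom, rule refl)
  also have "\<dots> = (\<Sum>j\<in>I. \<Sum>k\<in>I. if k = j then 1 else 0)"
    using sep by (intro sum.cong refl) (auto simp: fourier_atom intro!: tent_eq_0)
  also have "\<dots> = of_nat (card I)" using I by simp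
  finally have P_int: "(\<integral>x. Re (P x) \<partial>lborel) = card I"
    using intP by simp
  have "(\<integral>x. atom 0 x \<partial>lborel) = 1"
    using fourier_atom[of 0 0] by (simp add: fourier_def)
  then have atom_int: "(\<integral>x. Re (atom 0 x) \<partial>lborel) = 1"
    using integrable_atom by simp
  have "(\<integral>x. norm (?h x) \<partial>lborel) \<le> (\<integral>x. (Re (P x) / s + s * Re (atom 0 x)) / 2 \<partial>lborel)"
  proof (rule integral_mono_AE)
    show "integrable lborel (\<lambda>x. norm (?h x))"
      by (intro integrable_norm Bochner_Integration.integrable_sum integrable_atom)
    show "integrable lborel (\<lambda>x. (Re (P x) / s + s * Re (atom 0 x)) / 2)"
      using intP integrable_atom by simp
    have "norm (?h x) \<le> (Re (P x) / s + s * Re (atom 0 x)) / 2" if "x \<noteq> 0" for x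
    proof -
      define r where "r = (1 - cos x) / (pi * x\<^sup>2)"
      define a where "a = norm (m x)"
      have r: "atom 0 x = of_real r" "0 \<le> r" using that atom_0_eq by (auto simp: r_def)
      have "P x = m x * cnj (m x) * of_real r"
        unfolding P h r(1) by (simp add: mult_ac)
      then have "Re (P x) = a * a * r"
        unfolding complex_norm_square[symmetric] a_def by (simp add: power2_eq_square)
      moreover have "norm (?h x) = a * r" unfolding h using r by (simp add: norm_mult a_def)
      \<comment> \<open>Nonnegativity of this square, weighted by the density \<open>r\<close>, is
        the quadratic inequality behind the bound.\<close>
      moreover have "0 \<le> r * (a - s)\<^sup>2 / s" using r(2) s(1) by simp
      moreover have "r * (a - s)\<^sup>2 / s = a * a * r / s + s * r - 2 * (a * r)"
        using s(1) by (simp add: field_simps power2_eq_square)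
      ultimately show ?thesis using r(1) by simp
    qed
    then show "AE x in lborel. norm (?h x) \<le> (Re (P x) / s + s * Re (atom 0 x)) / 2"
      by (intro eventually_mono[OF AE_lborel_singleton[of 0]])
  qed
  also have "\<dots> = (card I / s + s) / 2"
    using P_int atom_int intP integrable_atom by simp
  also have "\<dots> = s" using s by (simp add: field_simps)
  finally show ?thesis by (simp add: L1norm_def s_def)
qed

text \<open>A function in \<open>BR\<close> is a uniformly convergent sum of its Littlewood-Paley
  pieces. Pieces outside \<open>S\<close> are annihilated by \<open>g\<close>, because the product
  of the two spectra vanishes, so only those in \<open>S\<close> contribute.\<close>

lemma BR_conv_bound:
  assumes F: "F \<in> BR" and g: "integrable lborel g" and S: "finite S"
    and disj: "\<And>j u. j \<notin> S \<Longrightarrow> psi j u * fourier g u = 0"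
  shows "norm (conv F g x) \<le> L1norm g * (\<Sum>j\<in>S. supnorm (conv F (phi j)))"
proof -
  let ?v = "\<lambda>j. conv F (phi j)"
  let ?s = "\<lambda>j. supnorm (?v j)"
  have "F \<in> BUCR" and sm: "?s summable_on UNIV" and sum: "\<And>y. ((\<lambda>j. ?v j y) has_sum F y) UNIV"
    using F by (auto simp: BR_def)
  then obtain M where M: "\<And>t. norm (F t) \<le> M" and "continuous_on UNIV F"
    by (auto simp: BUCR_def bounded_iff dest: uniformly_continuous_imp_continuous)
  then have Fm: "F \<in> borel_measurable borel" by (intro borel_measurable_continuous_onI)
  have vm: "?v j \<in> borel_measurable borel" for j
    using borel_measurable_conv[OF Fm] borel_measurable_integrable[OF integrable_phi] by simp
  have vM: "norm (?v j y) \<le> M * L1norm (phi j)" for j y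
    by (rule norm_conv_le[OF M integrable_phi])
  have vs: "norm (?v j y) \<le> ?s j" for j y
    using vM by (intro supnorm_upper) (auto simp: bounded_iff)
  have s0: "0 \<le> ?s j" for j using order_trans[OF norm_ge_zero vs] .
  have zero: "conv (?v j) g x = 0" if "j \<notin> S" for j
  proof -
    have "conv (phi j) g = (\<lambda>x. 0)"
      unfolding phi_eq_inv_fourier conv_inv_fourier[OF integrable_psi g] fun_eq_iff
        inv_fourier_def disj[OF that] by simp
    then show ?thesis
      unfolding conv_conv[OF Fm M integrable_phi g] by (simp add: conv_def)
  qed
  have approx: "norm (conv F g x) \<le> L1norm g * (\<Sum>j\<in>S. ?s j) + e * L1norm g" if e: "e > 0" for e
  proof -
    obtain T0 where T0: "finite T0" "dist (sum ?s T0) (infsum ?s UNIV) \<le> e"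
      using infsum_finite_approximation[OF sm e] by auto
    \<comment> \<open>\<open>T0\<close> makes the remainder uniformly small, while including
      \<open>S\<close> lets the finite sum reduce to exactly the pieces indexed by
      \<open>S\<close>.\<close>
    define T where "T = T0 \<union> S"
    have T: "finite T" "S \<subseteq> T" "T0 \<subseteq> T" using T0 S by (auto simp: T_def)
    define R where "R = (\<lambda>y. F y - (\<Sum>j\<in>T. ?v j y))"
    have R: "norm (R y) \<le> e" for y
    proof -
      have "norm (R y) \<le> infsum ?s UNIV - sum ?s T"
        unfolding R_def
        by (rule norm_infsum_le[OF has_sum_Diff[OF sum has_sum_finite[OF T(1)]]
              has_sum_Diff[OF has_sum_infsum[OF sm] has_sum_finite[OF T(1)]]]) (use vs in auto)
      also have "\<dots> \<le> infsum ?s UNIV - sum ?s T0"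
        using T s0 by (intro diff_left_mono sum_mono2) auto
      also have "\<dots> \<le> e" using T0(2) by (simp add: dist_real_def)
      finally show ?thesis .
    qed
    have "R \<in> borel_measurable borel" unfolding R_def using Fm vm by (intro borel_measurable_diff borel_measurable_sum)
    then have intR: "integrable lborel (\<lambda>t. R (x - t) * g t)"
      by (rule integrable_conv_integrand[OF _ R g])
    have intv: "integrable lborel (\<lambda>t. ?v j (x - t) * g t)" for j
      by (rule integrable_conv_integrand[OF vm vM g])
    have "conv F g x = (\<integral>t. R (x - t) * g t + (\<Sum>j\<in>T. ?v j (x - t)) * g t \<partial>lborel)"
      by (simp add: R_def conv_def algebra_simps)
    also have "\<dots> = conv R g x + conv (\<lambda>y. \<Sum>j\<in>T. ?v j y) g x"
      unfolding conv_def[of R] conv_def[of "\<lambda>y. \<Sum>j\<in>T. ?v j y"]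
      by (intro Bochner_Integration.integral_add intR)
         (simp only: sum_distrib_right Bochner_Integration.integrable_sum intv)
    also have "conv (\<lambda>y. \<Sum>j\<in>T. ?v j y) g x = (\<Sum>j\<in>T. conv (?v j) g x)"
      by (rule conv_sum_left[OF intv])
    also have "\<dots> = (\<Sum>j\<in>S. conv (?v j) g x)"
      using T zero by (intro sum.mono_neutral_right) auto
    finally have "norm (conv F g x) \<le> norm (conv R g x) + (\<Sum>j\<in>S. norm (conv (?v j) g x))"
      by (metis norm_triangle_le add_left_mono norm_sum)
    also have "\<dots> \<le> e * L1norm g + (\<Sum>j\<in>S. ?s j * L1norm g)"
      by (intro add_mono sum_mono norm_conv_le R vs g)
    finally show ?thesis by (simp add: sum_distrib_left mult_ac)
  qed
  show ?thesis
  proof (rule field_le_epsilon)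
    fix d :: real assume d: "d > 0"
    \<comment> \<open>Adding 1 keeps the denominator positive even when the norm of \<open>g\<close>
      is zero.\<close>
    define e where "e = d / (L1norm g + 1)"
    have e: "e > 0" using d L1norm_nonneg[of g] by (simp add: e_def)
    have "e * L1norm g \<le> d"
      using d L1norm_nonneg[of g] by (simp add: e_def field_simps)
    with approx[OF e] show "norm (conv F g x) \<le> L1norm g * (\<Sum>j\<in>S. ?s j) + d" by linarith
  qed
qed

section \<open>The separating function\<close>

lemma inv_fourier_zero [simp]: "inv_fourier (\<lambda>u. 0) x = 0"
  by (simp add: inv_fourier_def)

lemma conv_translate: "conv (\<lambda>t. F (t - a)) h x = conv F h (x - a)"
  by (simp add: conv_def algebra_simps)

text \<open>The majorant \<open>a n * L1norm g\<close> of the integrated norms is summable, which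
  permits exchanging sum and integral.\<close>

lemma conv_suminf:
  fixes G :: "nat \<Rightarrow> real \<Rightarrow> complex"
  assumes G: "\<And>n. G n \<in> borel_measurable borel" "\<And>n y. norm (G n y) \<le> a n" and a: "summable a"
    and g: "integrable lborel g"
  shows "(\<lambda>n. conv (G n) g x) sums conv (\<lambda>y. \<Sum>n. G n y) g x"
proof -
  have "summable (\<lambda>n. norm (G n y))" for y
    using G(2) by (intro summable_comparison_test'[OF a]) simp
  then have eq: "(\<Sum>n. G n y * c) = (\<Sum>n. G n y) * c" for y c
    by (rule suminf_mult2[OF summable_norm_cancel, symmetric])
  have "(\<lambda>n. \<integral>t. G n (x - t) * g t \<partial>lborel) sums (\<integral>t. (\<Sum>n. G n (x - t) * g t) \<partial>lborel)"
  proof (rule sums_integral)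
    show "integrable lborel (\<lambda>t. G n (x - t) * g t)" for n
      by (rule integrable_conv_integrand[OF G g])
    show "AE t in lborel. summable (\<lambda>n. norm (G n (x - t) * g t))"
      using \<open>\<And>y. summable (\<lambda>n. norm (G n y))\<close> by (intro AE_I2) (simp add: norm_mult summable_mult2)
    have "(\<integral>t. norm (G n (x - t) * g t) \<partial>lborel) \<le> a n * L1norm g" for n
    proof -
      have "(\<integral>t. norm (G n (x - t) * g t) \<partial>lborel) \<le> (\<integral>t. a n * norm (g t) \<partial>lborel)"
        using g G(2) order_trans[OF norm_ge_zero G(2)]
        by (intro integral_mono') (auto simp: norm_mult intro: mult_right_mono)
      then show ?thesis by (simp add: L1norm_def)
    qed
    then show "summable (\<lambda>n. \<integral>t. norm (G n (x - t) * g t) \<partial>lborel)"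
      by (intro summable_comparison_test'[OF summable_mult2[OF a, of "L1norm g"]]) simp
  qed
  then show ?thesis unfolding conv_def eq .
qed

text \<open>The radius-1 tent centred at \<open>3 * 4 ^ k\<close> lies between
  \<open>2 * 4 ^ k\<close> and \<open>4 * 4 ^ k\<close>, that is, between the consecutive powers
  \<open>2 ^ (2 * k + 1)\<close> and \<open>2 ^ (2 * k + 2)\<close>. This separates the spectra and
  places each in a single octave.\<close>

definition freq :: "nat \<Rightarrow> real" where
  "freq k = 3 * 4 ^ k"

definition block :: "nat \<Rightarrow> nat set" where
  "block n = {2 ^ n..<2 ^ Suc n}"

lemma finite_block [simp]: "finite (block n)"
  and card_block [simp]: "card (block n) = 2 ^ n"
  by (simp_all add: block_def)

lemma block_disjoint: "k \<in> block m \<Longrightarrow> k \<in> block n \<Longrightarrow> m = n"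
proof (induction m n rule: linorder_wlog)
  case (le m n)
  show ?case
  proof (rule ccontr)
    assume "m \<noteq> n"
    with le have "Suc m \<le> n" by simp
    then have "(2::nat) ^ Suc m \<le> 2 ^ n" by (rule power_increasing) simp
    with le show False by (auto simp: block_def)
  qed
qed auto

text \<open>The gap 2 is the sum of the radii of two tents, so their nonzero sets are
  disjoint.\<close>

lemma freq_separated: "j \<noteq> k \<Longrightarrow> 2 \<le> \<bar>freq j - freq k\<bar>"
proof (induction j k rule: linorder_wlog)
  case (le j k)
  then have "(4::real) ^ Suc j \<le> 4 ^ k" by (intro power_increasing) auto
  moreover have "(1::real) \<le> 4 ^ j" by simp
  ultimately show ?case unfolding freq_def power_Suc by linarith
qed (simp add: abs_minus_commute)

lemma tent_disjoint: "2 \<le> \<bar>l - m\<bar> \<Longrightarrow> tent (u - l) = 0 \<or> tent (u - m) = 0"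
  using tent_eq_0[of "u - l"] tent_eq_0[of "u - m"] by linarith

lemma tent_freq_disjoint: "j \<noteq> k \<Longrightarrow> tent (u - freq j) = 0 \<or> tent (u - freq k) = 0"
  by (intro tent_disjoint freq_separated)

lemma integrable_tent_mult:
  assumes "continuous_on UNIV q"
  shows "integrable lborel (\<lambda>u. tent (u - l) * q u)"
  by (rule integrable_continuous_compact_support[where a = "l - 1" and b = "l + 1"])
     (auto intro!: continuous_intros assms tent_eq_0)

text \<open>The convolution square of \<open>atom (freq k)\<close>, given by its spectrum.\<close>

abbreviation bump :: "nat \<Rightarrow> real \<Rightarrow> complex" where
  "bump k \<equiv> inv_fourier (\<lambda>u. tent (u - freq k) * tent (u - freq k))"

lemma conv_atom_atom:
  "conv (atom (freq p)) (atom (freq q)) x = (if p = q then bump p x else 0)"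
proof -
  have "(\<lambda>u. tent (u - freq p) * tent (u - freq q)) = (\<lambda>u. 0)" if "p \<noteq> q"
    using tent_freq_disjoint[OF that] by auto
  then show ?thesis
    unfolding atom_def[of "freq p"] conv_inv_fourier[OF integrable_tent integrable_atom] fourier_atom
    by simp
qed

text \<open>The value at 0 of the threefold convolution of the Fejer kernel with itself; this is the
  constant \<open>c\<close> of the overview.\<close>

definition peak :: complex where
  "peak = inv_fourier (\<lambda>u. tent u * tent u * tent u) 0"

text \<open>Up to the factor \<open>1 / (2 * pi)\<close> it is the integral of the cubed tent, which
  is nonnegative and at least \<open>(1/2) ^ 3\<close> on an interval of length 1.\<close>

lemma peak_nonzero: "peak \<noteq> 0"
proof -
  let ?t = "\<lambda>u::real. max 0 (1 - \<bar>u\<bar>)"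
  have int: "integrable lborel (\<lambda>u. ?t u * ?t u * ?t u)"
    by (rule integrable_continuous_compact_support[where a = "- 1" and b = 1]) (auto intro!: continuous_intros)
  have "(\<integral>u. indicator {- 1/2..1/2::real} u * (1/8) \<partial>lborel) \<le> (\<integral>u. ?t u * ?t u * ?t u \<partial>lborel)"
  proof (rule integral_mono_AE[OF _ int])
    show "AE u in lborel. indicator {- 1/2..1/2::real} u * (1/8) \<le> ?t u * ?t u * ?t u"
    proof (intro AE_I2)
      fix u :: real
      show "indicator {- 1/2..1/2::real} u * (1/8) \<le> ?t u * ?t u * ?t u"
      proof (cases "u \<in> {- 1/2..1/2}")
        case True
        then have "1/2 \<le> ?t u" by auto
        then have "(1/2) ^ 3 \<le> ?t u ^ 3" by (rule power_mono) simp
        with True show ?thesis unfolding power3_eq_cube by simp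
      qed simp
    qed
  qed simp
  then have "1 / (2 * pi) * (\<integral>u. ?t u * ?t u * ?t u \<partial>lborel) \<noteq> 0" by simp
  moreover have "peak = of_real (1 / (2 * pi) * (\<integral>u. ?t u * ?t u * ?t u \<partial>lborel))"
    unfolding peak_def inv_fourier_def tent_def of_real_mult
    by (simp flip: of_real_mult del: of_real_mult)
  ultimately show ?thesis by (metis of_real_eq_0_iff)
qed

text \<open>The argument \<open>real k - real p\<close> arises from a bump translated by
  \<open>p\<close> and read off at the point \<open>k\<close>. For \<open>p = k\<close> it is 0, so
  the modulation drops out and the value no longer depends on \<open>k\<close>; otherwise the
  spectra are disjoint.\<close>

lemma conv_bump_atom:
  "conv (bump p) (atom (freq k)) (real k - real p) = (if p = k then peak else 0)"
proof -
  have "conv (bump p) (atom (freq k)) (real k - real p) =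
      inv_fourier (\<lambda>u. tent (u - freq p) * tent (u - freq p) * tent (u - freq k)) (real k - real p)"
    by (subst conv_inv_fourier[OF integrable_tent_mult integrable_atom])
       (auto intro!: continuous_intros simp: fourier_atom)
  also have "\<dots> = (if p = k then peak else 0)"
  proof (cases "p = k")
    case True
    then show ?thesis
      using lborel_integral_shift[of "\<lambda>u. tent u * tent u * tent u" "freq k"]
      by (simp add: inv_fourier_def peak_def)
  next
    case False
    then have "(\<lambda>u. tent (u - freq p) * tent (u - freq p) * tent (u - freq k)) = (\<lambda>u. 0)"
      using tent_freq_disjoint[OF False] by auto
    with False show ?thesis by simp
  qed
  finally show ?thesis .
qed

section \<open>The two factors and their series\<close>

definition left_factor :: "nat \<Rightarrow> real \<Rightarrow> complex" where
  "left_factor n t = (\<Sum>k\<in>block n. atom (freq k) (t - real k))"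

definition right_factor :: "nat \<Rightarrow> real \<Rightarrow> complex" where
  "right_factor n t = (\<Sum>k\<in>block n. of_real (1 / 2 ^ n) * atom (freq k) t)"

definition witness :: "real \<Rightarrow> complex" where
  "witness x = (\<Sum>n. conv (left_factor n) (right_factor n) x)"

text \<open>Of the double sum over a block only the diagonal survives, since atoms of different
  frequencies convolve to zero.\<close>

lemma conv_factors:
  "conv (left_factor n) (right_factor n) x = (\<Sum>k\<in>block n. of_real (1 / 2 ^ n) * bump k (x - real k))"
proof -
  obtain C where C: "\<And>l x. norm (atom l x) \<le> C" using norm_atom_bounded by blast
  have m: "(\<lambda>t. atom l (t - a)) \<in> borel_measurable borel" for l a by measurable
  have int: "integrable lborel (\<lambda>t. of_real (1 / 2 ^ n) * atom l t)" for l
    by (intro integrable_mult_right integrable_atom)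
  have "conv (left_factor n) (right_factor n) x =
      (\<Sum>p\<in>block n. conv (\<lambda>t. atom (freq p) (t - real p)) (right_factor n) x)"
    unfolding left_factor_def
    by (rule conv_sum_left, rule integrable_conv_integrand[OF m C])
       (simp add: right_factor_def integrable_atom)
  also have "\<dots> = (\<Sum>p\<in>block n. \<Sum>q\<in>block n.
      conv (\<lambda>t. atom (freq p) (t - real p)) (\<lambda>t. of_real (1 / 2 ^ n) * atom (freq q) t) x)"
    unfolding right_factor_def by (intro sum.cong refl conv_sum_right integrable_conv_integrand[OF m C int])
  also have "\<dots> = (\<Sum>p\<in>block n. \<Sum>q\<in>block n. of_real (1 / 2 ^ n) * conv (atom (freq p)) (atom (freq q)) (x - real p))"
  proof (intro sum.cong refl)
    fix p q
    have "conv F (\<lambda>t. c * h t) y = c * conv F h y" for F h c y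
      by (simp add: conv_def mult.left_commute)
    then show "conv (\<lambda>t. atom (freq p) (t - real p)) (\<lambda>t. of_real (1 / 2 ^ n) * atom (freq q) t) x =
        of_real (1 / 2 ^ n) * conv (atom (freq p)) (atom (freq q)) (x - real p)"
      by (simp only: conv_translate)
  qed
  also have "\<dots> = (\<Sum>p\<in>block n. \<Sum>q\<in>block n. if p = q then of_real (1 / 2 ^ n) * bump p (x - real p) else 0)"
    by (intro sum.cong refl) (simp add: conv_atom_atom)
  also have "\<dots> = (\<Sum>k\<in>block n. of_real (1 / 2 ^ n) * bump k (x - real k))"
    by simp
  finally show ?thesis .
qed

lemma continuous_on_bump: "continuous_on UNIV (bump k)"
  by (intro continuous_on_inv_fourier integrable_tent_mult continuous_intros)

lemma continuous_on_conv_factors: "continuous_on UNIV (conv (left_factor n) (right_factor n))"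
proof -
  have "continuous_on UNIV (\<lambda>x. bump k (x - real k))" for k
    by (intro continuous_on_compose2[OF continuous_on_bump[of k]] continuous_intros) auto
  then show ?thesis unfolding conv_factors[abs_def] by (intro continuous_intros)
qed

lemma left_factor_in_C0R: "left_factor n \<in> C0R"
proof -
  have "continuous_on UNIV (\<lambda>t. atom l (t - a))" for l a
    by (intro continuous_on_compose2[OF continuous_on_atom] continuous_intros) auto
  then have "continuous_on UNIV (left_factor n)"
    unfolding left_factor_def[abs_def] by (intro continuous_intros)
  moreover have "(left_factor n \<longlongrightarrow> 0) at_infinity"
    unfolding left_factor_def[abs_def]
  proof (rule tendsto_null_sum)
    fix k
    obtain C where C: "\<And>l x. norm (atom l x) \<le> C / (1 + x\<^sup>2)" using atom_decay by blast
    have "((\<lambda>t. C / (1 + (t - real k)\<^sup>2)) \<longlongrightarrow> 0) at_infinity"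
      unfolding at_infinity_eq_at_top_bot by (rule filterlim_sup; real_asymp)
    then show "((\<lambda>t. atom (freq k) (t - real k)) \<longlongrightarrow> 0) at_infinity"
      by (rule Lim_null_comparison[rotated]) (simp add: C)
  qed
  ultimately show ?thesis by (simp add: C0R_def)
qed

text \<open>The decay is uniform in the frequency and the shifts are distinct integers, so the
  Cauchy weights give one bound for all blocks, however many atoms they contain.\<close>

lemma left_factor_bounded: "\<exists>K. \<forall>n t. norm (left_factor n t) \<le> K"
proof -
  obtain C where C: "\<And>l x. norm (atom l x) \<le> C / (1 + x\<^sup>2)" using atom_decay by blast
  obtain K where K: "\<And>I t. finite I \<Longrightarrow> (\<Sum>k\<in>I. 1 / (1 + (t - real k)\<^sup>2)) \<le> K"
    using sum_cauchy_weights_bounded by blast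
  have "0 \<le> C" using order_trans[OF norm_ge_zero C[of 0 0]] by simp
  have "norm (left_factor n t) \<le> C * K" for n t
  proof -
    have "norm (left_factor n t) \<le> (\<Sum>k\<in>block n. C * (1 / (1 + (t - real k)\<^sup>2)))"
      unfolding left_factor_def using C by (intro sum_norm_le) simp
    also have "\<dots> \<le> C * K"
      unfolding sum_distrib_left[symmetric] using \<open>0 \<le> C\<close> K by (intro mult_left_mono) auto
    finally show ?thesis .
  qed
  then show ?thesis by blast
qed

lemma right_factor_in_H1R: "right_factor n \<in> H1R"
proof -
  have int: "integrable lborel (right_factor n)"
    unfolding right_factor_def[abs_def]
    by (intro Bochner_Integration.integrable_sum integrable_mult_right integrable_atom)
  have "fourier (right_factor n) u = 0" if "u \<le> 0" for u
  proof -
    have "fourier (right_factor n) u = (\<Sum>k\<in>block n. of_real (1 / 2 ^ n) * fourier (atom (freq k)) u)"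
      unfolding fourier_def right_factor_def sum_distrib_right mult.assoc
      by (subst Bochner_Integration.integral_sum)
         (intro integrable_mult_right integrable_mult_exp integrable_atom, simp only: integral_mult_right_zero)
    also have "\<dots> = 0"
    proof (intro sum.neutral ballI)
      fix k
      \<comment> \<open>All frequencies are at least 3, so a nonpositive \<open>u\<close> lies
        outside every tent.\<close>
      have "(1::real) \<le> 4 ^ k" by simp
      then have "1 \<le> \<bar>u - freq k\<bar>" using that unfolding freq_def by linarith
      then show "of_real (1 / 2 ^ n) * fourier (atom (freq k)) u = 0"
        by (simp add: fourier_atom tent_eq_0)
    qed
    finally show ?thesis .
  qed
  with int show ?thesis by (simp add: H1R_def)
qed

lemma L1norm_right_factor: "L1norm (right_factor n) \<le> (1 / sqrt 2) ^ n"
proof -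
  have "L1norm (right_factor n) = 1 / 2 ^ n * L1norm (\<lambda>t. \<Sum>k\<in>block n. atom (freq k) t)"
    unfolding L1norm_def right_factor_def sum_distrib_left[symmetric] norm_mult
    by (simp add: norm_divide norm_power)
  also have "\<dots> \<le> 1 / 2 ^ n * sqrt (real (card (block n)))"
  proof (intro mult_left_mono L1norm_sum_atoms_le)
    show "1 \<le> \<bar>freq j - freq k\<bar>" if "j \<noteq> k" for j k using freq_separated[OF that] by simp
  qed auto
  also have "\<dots> = (1 / sqrt 2) ^ n"
  proof -
    have "sqrt (2 ^ n) * sqrt (2 ^ n) = (2::real) ^ n" by simp
    then show ?thesis by (simp add: power_divide real_sqrt_power field_simps)
  qed
  finally show ?thesis .
qed

text \<open>One geometric majorant serves both the norm condition of the algebra and the uniform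
  convergence of the series; its ratio \<open>1 / sqrt 2\<close> comes from the right
  factors.\<close>

lemma factors_summable: "\<exists>a. summable a \<and> (\<forall>n. supnorm (left_factor n) * L1norm (right_factor n) \<le> a n)
    \<and> (\<forall>n x. norm (conv (left_factor n) (right_factor n) x) \<le> a n)"
proof -
  obtain K where K: "\<And>n t. norm (left_factor n t) \<le> K" using left_factor_bounded by blast
  have "0 \<le> K" using order_trans[OF norm_ge_zero K] .
  have "summable (\<lambda>n. K * (1 / sqrt 2) ^ n)"
    by (intro summable_mult summable_geometric) simp
  moreover have "supnorm (left_factor n) * L1norm (right_factor n) \<le> K * (1 / sqrt 2) ^ n" for n
    using \<open>0 \<le> K\<close> by (intro mult_mono supnorm_least K L1norm_right_factor L1norm_nonneg)
  moreover have "norm (conv (left_factor n) (right_factor n) x) \<le> K * (1 / sqrt 2) ^ n" for n x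
  proof -
    have "norm (conv (left_factor n) (right_factor n) x) \<le> K * L1norm (right_factor n)"
      using right_factor_in_H1R by (intro norm_conv_le K) (auto simp: H1R_def)
    also have "\<dots> \<le> K * (1 / sqrt 2) ^ n"
      by (intro mult_left_mono L1norm_right_factor \<open>0 \<le> K\<close>)
    finally show ?thesis .
  qed
  ultimately show ?thesis by blast
qed

text \<open>Stated for every \<open>X\<close> above \<open>C0R\<close>, so that one representation
  serves both algebras.\<close>

lemma witness_in_Aspace:
  assumes "C0R \<subseteq> X"
  shows "witness \<in> Aspace X"
proof -
  obtain a where a: "summable a" "\<And>n. supnorm (left_factor n) * L1norm (right_factor n) \<le> a n"
    "\<And>n x. norm (conv (left_factor n) (right_factor n) x) \<le> a n" using factors_summable by blast
  \<comment> \<open>\<open>supnorm\<close> is a real supremum, so its sign is derived from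
    boundedness of the range.\<close>
  have "0 \<le> supnorm (left_factor n)" for n
    using left_factor_in_C0R C0R_subset_BUCR order_trans[OF norm_ge_zero supnorm_upper[of "left_factor n"]]
    by (auto simp: BUCR_def)
  then have "summable (\<lambda>n. supnorm (left_factor n) * L1norm (right_factor n))"
    using a(2) L1norm_nonneg by (intro summable_comparison_test'[OF a(1)]) (simp add: abs_mult)
  moreover have "(\<lambda>n. conv (left_factor n) (right_factor n) x) sums witness x" for x
    unfolding witness_def using a(3) by (intro summable_sums summable_comparison_test'[OF a(1)])
  ultimately show ?thesis
    unfolding Aspace_def using assms left_factor_in_C0R right_factor_in_H1R by blast
qed

lemma continuous_bounded_witness: "continuous_on UNIV witness" "\<exists>M. \<forall>x. norm (witness x) \<le> M"
proof -
  obtain a where a: "summable a" "\<And>n x. norm (conv (left_factor n) (right_factor n) x) \<le> a n"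
    using factors_summable by blast
  have "uniform_limit UNIV (\<lambda>N x. \<Sum>n<N. conv (left_factor n) (right_factor n) x) witness sequentially"
    unfolding witness_def[abs_def] using a by (intro Weierstrass_m_test)
  then show "continuous_on UNIV witness"
    by (rule uniform_limit_theorem[rotated])
       (auto intro!: always_eventually continuous_on_sum continuous_on_conv_factors)
  have "norm (witness x) \<le> suminf a" for x
    unfolding witness_def using a
    by (intro order_trans[OF summable_norm suminf_le]) (auto intro: summable_comparison_test'[OF a(1)])
  then show "\<exists>M. \<forall>x. norm (witness x) \<le> M" by blast
qed

text \<open>Convolving termwise with the atom leaves only the bump of index \<open>k\<close>. Its
  weight \<open>1 / 2 ^ n\<close> is that of the unique block containing \<open>k\<close>, and
  evaluation at \<open>k\<close> undoes its translation.\<close>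

lemma conv_witness_atom:
  assumes "k \<in> block n"
  shows "conv witness (atom (freq k)) (real k) = peak / 2 ^ n"
proof -
  obtain a where a: "summable a" "\<And>n x. norm (conv (left_factor n) (right_factor n) x) \<le> a n"
    using factors_summable by blast
  have "(\<lambda>m. conv (conv (left_factor m) (right_factor m)) (atom (freq k)) (real k)) sums
      conv witness (atom (freq k)) (real k)"
    unfolding witness_def[abs_def]
    by (rule conv_suminf[OF borel_measurable_continuous_onI[OF continuous_on_conv_factors] a(2,1) integrable_atom])
  moreover have "conv (conv (left_factor m) (right_factor m)) (atom (freq k)) (real k) =
      (if m = n then peak / 2 ^ n else 0)" for m
  proof -
    have int: "integrable lborel (\<lambda>t. of_real (1 / 2 ^ m) * bump p (real k - t - real p) * atom (freq k) t)" for p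
    proof (rule integrable_conv_integrand[where F = "\<lambda>y. of_real (1 / 2 ^ m) * bump p (y - real p)", OF _ _ integrable_atom])
      show "(\<lambda>y. of_real (1 / 2 ^ m) * bump p (y - real p)) \<in> borel_measurable borel"
        by (intro borel_measurable_continuous_onI continuous_intros continuous_on_compose2[OF continuous_on_bump]) auto
      show "norm (of_real (1 / 2 ^ m) * bump p (y - real p)) \<le>
          norm (complex_of_real (1 / 2 ^ m)) * ((\<integral>u. norm (tent (u - freq p) * tent (u - freq p)) \<partial>lborel) / (2 * pi))" for y
        unfolding norm_mult[of "of_real (1 / 2 ^ m)"] by (intro mult_left_mono norm_inv_fourier_le) auto
    qed
    have "conv (conv (left_factor m) (right_factor m)) (atom (freq k)) (real k) =
        (\<Sum>p\<in>block m. conv (\<lambda>y. of_real (1 / 2 ^ m) * bump p (y - real p)) (atom (freq k)) (real k))"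
      unfolding conv_factors[abs_def] by (intro conv_sum_left int)
    also have "\<dots> = (\<Sum>p\<in>block m. of_real (1 / 2 ^ m) * conv (bump p) (atom (freq k)) (real k - real p))"
    proof (intro sum.cong refl)
      fix p
      have "conv (\<lambda>y. c * F y) h y = c * conv F h y" for F h c y
        by (simp add: conv_def mult.assoc)
      then show "conv (\<lambda>y. of_real (1 / 2 ^ m) * bump p (y - real p)) (atom (freq k)) (real k) =
          of_real (1 / 2 ^ m) * conv (bump p) (atom (freq k)) (real k - real p)"
        by (simp only: conv_translate)
    qed
    also have "\<dots> = (\<Sum>p\<in>block m. if p = k then peak / 2 ^ m else 0)"
      by (intro sum.cong refl) (simp add: conv_bump_atom)
    also have "\<dots> = (if k \<in> block m then peak / 2 ^ m else 0)"
      by simp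
    also have "k \<in> block m \<longleftrightarrow> m = n" using block_disjoint[OF _ assms] assms by blast
    finally show ?thesis by simp
  qed
  ultimately have "(\<lambda>m. if m = n then peak / 2 ^ n else 0) sums conv witness (atom (freq k)) (real k)"
    by simp
  then show ?thesis using sums_single[of n "\<lambda>m. peak / 2 ^ n"] sums_unique2 by blast
qed

section \<open>Failure of the Besov condition\<close>

lemma psi_tent_disjoint:
  assumes "j \<notin> {2 * int k + 1, 2 * int k + 2}"
  shows "psi j u * tent (u - freq k) = 0"
proof (rule ccontr)
  assume nz: "psi j u * tent (u - freq k) \<noteq> 0"
  then have "besov_psi (2 powr (- real_of_int j) * u) \<noteq> 0" by auto
  then have b: "1 / 2 \<le> 2 powr (- real_of_int j) * u" "2 powr (- real_of_int j) * u \<le> 2"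
    using besov_psi_support by blast+
  have "\<bar>u - freq k\<bar> < 1" using nz tent_eq_0[of "u - freq k"] by force
  moreover have "(1::real) \<le> 4 ^ k" by simp
  ultimately have u: "2 * 4 ^ k < u" "u < 4 * 4 ^ k" unfolding freq_def by linarith+
  have four: "(4::real) ^ k = 2 powr (2 * real k)"
    by (simp add: powr_realpow[symmetric] powr_powr[symmetric])
  have "u = 2 powr real_of_int j * (2 powr (- real_of_int j) * u)"
    by (simp add: powr_minus)
  then have u2: "2 powr real_of_int j * (1 / 2) \<le> u" "u \<le> 2 powr real_of_int j * 2"
    using b by (metis mult_left_mono powr_ge_zero)+
  \<comment> \<open>Strictness matters here and in the companion bound below: it excludes
    \<open>j = 2 * k\<close> and \<open>j = 2 * k + 3\<close>, whose dyadic intervals touch the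
    octave of the tent only at an endpoint.\<close>
  have "2 powr (2 * real k + 1) < 2 powr (real_of_int j + 1)"
    using less_le_trans[OF u(1) u2(2)] unfolding four powr_add by (simp only: powr_one mult.commute)
  then have "2 * real k < real_of_int j" by simp
  moreover have "2 powr (real_of_int j - 1) < 2 powr (2 * real k + 2)"
    using le_less_trans[OF u2(1) u(2)] unfolding four powr_add powr_diff by simp
  then have "real_of_int j - 1 < 2 * real k + 2" by simp
  ultimately have "2 * int k < j" "j - 1 < 2 * int k + 2" by linarith+
  with assms show False by auto
qed

text \<open>Each \<open>k\<close> in block \<open>n\<close> forces two Littlewood-Paley norms to add
  up to at least a constant times \<open>1 / 2 ^ n\<close>. The \<open>2 ^ n\<close> indices of the
  block together contribute a fixed positive amount, contradicting the Cauchy criterion.\<close>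

lemma witness_notin_BR: "witness \<notin> BR"
proof
  assume F: "witness \<in> BR"
  define s where "s = (\<lambda>j. supnorm (conv witness (phi j)))"
  define d where "d = (\<lambda>k. s (2 * int k + 1) + s (2 * int k + 2))"
  have s: "s summable_on UNIV" using F by (simp add: BR_def s_def)
  have "(s \<circ> (\<lambda>k. 2 * int k + c)) summable_on UNIV" for c
    using summable_on_subset_banach[OF s, of "range (\<lambda>k. 2 * int k + c)"]
    by (subst summable_on_reindex[symmetric]) (auto intro!: injI)
  from summable_on_add[OF this[of 1] this[of 2]] have "summable d"
    unfolding d_def by (intro summable_on_imp_summable) (simp add: o_def)
  define L where "L = L1norm (atom 0)"
  have L: "L1norm (atom l) = L" for l unfolding L_def L1norm_def by (simp add: norm_atom[of l])
  have "norm peak / 2 ^ n \<le> L * d k" if "k \<in> block n" for n k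
  proof -
    have "norm (conv witness (atom (freq k)) (real k)) \<le>
        L1norm (atom (freq k)) * (\<Sum>j\<in>{2 * int k + 1, 2 * int k + 2}. supnorm (conv witness (phi j)))"
      using psi_tent_disjoint by (intro BR_conv_bound[OF F integrable_atom]) (auto simp: fourier_atom)
    then show ?thesis
      by (simp add: conv_witness_atom[OF that] L d_def s_def norm_divide norm_power)
  qed
  then have "(\<Sum>k\<in>block n. norm peak / 2 ^ n) \<le> (\<Sum>k\<in>block n. L * d k)" for n
    by (rule sum_mono)
  then have low: "norm peak \<le> L * (\<Sum>k\<in>block n. d k)" for n
    by (simp add: sum_distrib_left)
  have L0: "0 \<le> L" unfolding L_def by (rule L1norm_nonneg)
  \<comment> \<open>Chosen so that \<open>L * e < norm peak\<close>, with the added 1 covering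
    \<open>L = 0\<close> as well.\<close>
  define e where "e = norm peak / (L + 1)"
  have "e > 0" using peak_nonzero L0 by (simp add: e_def)
  then obtain N where N: "\<And>m n. N \<le> m \<Longrightarrow> norm (sum d {m..<n}) < e"
    using \<open>summable d\<close> unfolding summable_Cauchy by blast
  \<comment> \<open>Block \<open>N\<close> starts at \<open>2 ^ N\<close>, hence beyond the Cauchy
    threshold \<open>N\<close>.\<close>
  have "N \<le> 2 ^ N" by (simp add: less_imp_le)
  then have "norm (sum d (block N)) < e" unfolding block_def by (rule N)
  then have "L * (\<Sum>k\<in>block N. d k) \<le> L * e" using L0 by (intro mult_left_mono) auto
  also have "\<dots> < norm peak" using peak_nonzero L0 by (simp add: e_def field_simps)
  finally show False using low[of N] by simp
qed

text \<open>Another function in \<open>BR\<close> could a priori have the same extension; uniqueness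
  of bounded continuous boundary values rules this out.\<close>

lemma tilde_witness_notin: "tilde witness \<notin> halfplane_space BR"
proof
  assume "tilde witness \<in> halfplane_space BR"
  then obtain G where G: "G \<in> BR" "tilde witness = tilde G" by (auto simp: halfplane_space_def)
  then obtain M where M: "\<And>x. norm (G x) \<le> M" and "continuous_on UNIV G"
    by (auto simp: BR_def BUCR_def bounded_iff dest: uniformly_continuous_imp_continuous)
  moreover obtain K where "\<And>x. norm (witness x) \<le> K" using continuous_bounded_witness(2) by blast
  ultimately have "witness = G"
    using tilde_eq_imp_eq[OF G(2) continuous_bounded_witness(1)] by blast
  with G witness_notin_BR show False by simp
qed

theorem mainTheorem16:
  shows "halfplane_space BR \<noteq> halfplane_space AR \<and> halfplane_space B0R \<noteq> halfplane_space A0R"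
proof -
  have "tilde witness \<in> halfplane_space AR" "tilde witness \<in> halfplane_space A0R"
    using witness_in_Aspace C0R_subset_BUCR by (auto simp: halfplane_space_def AR_def A0R_def)
  moreover have "tilde witness \<notin> halfplane_space B0R"
    using tilde_witness_notin by (auto simp: halfplane_space_def B0R_def)
  ultimately show ?thesis using tilde_witness_notin by metis
qed

end
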